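(* Let $k$ be a field, $\mathbf a=(a_1,\dots,a_n)$ a vector of positive integers, and $A=k[x_{i,j} : 1\le i\le n,\ 0\le j\le a_i]$ with the $\mathbb Z^n$-grading $\deg x_{i,j}=\mathbf e_i$. Let $I\subseteq A$ be a multigraded ideal, $Z\subseteq\prod_{i=1}^n\mathbb A^{a_i+1}$ the scheme defined by $I$, and $\delta\ge 2$ an integer. If $I$ has a Gröbner basis (with respect to some term order) of forms of degree at most $\delta$, then for every vector $\mathbf b$ of $n$ positive integers the ideal of the correspondence scroll $C(Z;\mathbf b)$ has a Gröbner basis (with respect to some term order) of forms of degree at most $\delta$. Moreover, if the Gröbner basis of $I$ is squarefree, then the Gröbner basis of the ideal of $C(Z;\mathbf b)$ will also be squarefree.
   Context: Correspondence scroll: for $\mathbf b=(b_1,\dots,b_n)$ let $N=\sum_{i=1}^n\binom{a_i+b_i}{a_i}-1$ and let $S=k[z_{i,\alpha}]$ be the standard graded polynomial ring (homogeneous coordinate ring of $\mathbb P^N$) with one variable $z_{i,\alpha}$ for each $1\le i\le n$ and each $\alpha\in\mathbb N^{a_i+1}$ with $|\alpha|=b_i$. The ideal of $C(Z;\mathbf b)\subseteq\mathbb P^N$ is the kernel of the $k$-algebra map $S\to A/I$, $z_{i,\alpha}\mapsto x_i^\alpha=x_{i,0}^{\alpha_0}\cdots x_{i,a_i}^{\alpha_{a_i}}$. Degrees of forms are total degrees (standard grading, all variables of degree 1) in $A$ and in $S$. A Gröbner basis is called squarefree if its elements have squarefree leading monomials. *)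

theory Defs
  imports "HOL-Library.Poly_Mapping" "HOL-Algebra.QuotRing"
begin

section \<open>Polynomial rings with a prescribed set of variables\<close>

type_synonym 'v monomial = "'v \<Rightarrow>\<^sub>0 nat"
type_synonym ('v, 'k) mpoly = "'v monomial \<Rightarrow>\<^sub>0 'k"

definition monomials :: "'v set \<Rightarrow> 'v monomial set" where
  "monomials V = {m. Poly_Mapping.keys m \<subseteq> V}"

definition mpoly_ring :: "'v set \<Rightarrow> ('v, 'k::field) mpoly ring" where
  "mpoly_ring V = \<lparr>carrier = {p. Poly_Mapping.keys p \<subseteq> monomials V},
     mult = (*), one = 1, zero = 0, add = (+)\<rparr>"

definition mvar :: "'v \<Rightarrow> ('v, 'k::field) mpoly" where
  "mvar v = Poly_Mapping.single (Poly_Mapping.single v 1) 1"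

definition mconst :: "'k::field \<Rightarrow> ('v, 'k) mpoly" where
  "mconst c = Poly_Mapping.single 0 c"

text \<open>The \<open>k\<close>-algebra map sending each variable \<open>v\<close> to \<open>g v\<close>.\<close>

definition mpoly_subst ::
    "('v \<Rightarrow> ('w, 'k) mpoly) \<Rightarrow> ('v, 'k::field) mpoly \<Rightarrow> ('w, 'k) mpoly" where
  "mpoly_subst g p =
     (\<Sum>m\<in>Poly_Mapping.keys p. mconst (Poly_Mapping.lookup p m) *
        (\<Prod>v\<in>Poly_Mapping.keys m. g v ^ Poly_Mapping.lookup m v))"

definition total_degree :: "'v monomial \<Rightarrow> nat" where
  "total_degree m = (\<Sum>v\<in>Poly_Mapping.keys m. Poly_Mapping.lookup m v)"

definition form_of_degree :: "nat \<Rightarrow> ('v, 'k::field) mpoly \<Rightarrow> bool" where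
  "form_of_degree d p \<longleftrightarrow> (\<forall>m\<in>Poly_Mapping.keys p. total_degree m = d)"


section \<open>Groebner bases\<close>

text \<open>A term order is given as the set of pairs \<open>(s, t)\<close> with \<open>s \<le> t\<close>. For a finite
  set of variables such an order is automatically a well-order.\<close>

definition term_order :: "'v set \<Rightarrow> 'v monomial rel \<Rightarrow> bool" where
  "term_order V r \<longleftrightarrow>
     linear_order_on (monomials V) r \<and>
     (\<forall>t\<in>monomials V. (0, t) \<in> r) \<and>
     (\<forall>s\<in>monomials V. \<forall>t\<in>monomials V. \<forall>u\<in>monomials V. (s, t) \<in> r \<longrightarrow> (s + u, t + u) \<in> r)"

text \<open>Meaningful for nonzero polynomials only.\<close>

definition leading_monomial :: "'v monomial rel \<Rightarrow> ('v, 'k::field) mpoly \<Rightarrow> 'v monomial" where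
  "leading_monomial r p =
     (THE m. m \<in> Poly_Mapping.keys p \<and> (\<forall>m'\<in>Poly_Mapping.keys p. (m', m) \<in> r))"

text \<open>The ideal generated by the leading monomials of the nonzero elements of \<open>P\<close>; for an
  ideal \<open>P\<close> this is its initial ideal.\<close>

definition initial_ideal ::
    "'v set \<Rightarrow> 'v monomial rel \<Rightarrow> ('v, 'k::field) mpoly set \<Rightarrow> ('v, 'k) mpoly set" where
  "initial_ideal V r P =
     Idl\<^bsub>mpoly_ring V\<^esub> ((\<lambda>p. Poly_Mapping.single (leading_monomial r p) 1) ` (P - {0}))"

definition groebner_basis ::
    "'v set \<Rightarrow> 'v monomial rel \<Rightarrow> ('v, 'k::field) mpoly set \<Rightarrow> ('v, 'k) mpoly set \<Rightarrow> bool" where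
  "groebner_basis V r I G \<longleftrightarrow>
     finite G \<and> G \<subseteq> I - {0} \<and> initial_ideal V r G = initial_ideal V r I"

definition squarefree_basis :: "'v monomial rel \<Rightarrow> ('v, 'k::field) mpoly set \<Rightarrow> bool" where
  "squarefree_basis r G \<longleftrightarrow> (\<forall>g\<in>G. \<forall>v. Poly_Mapping.lookup (leading_monomial r g) v \<le> 1)"

definition forms_of_degree_le :: "nat \<Rightarrow> ('v, 'k::field) mpoly set \<Rightarrow> bool" where
  "forms_of_degree_le \<delta> G \<longleftrightarrow> (\<forall>g\<in>G. \<exists>d\<le>\<delta>. form_of_degree d g)"


section \<open>Multigraded ideals and correspondence scrolls\<close>

text \<open>The pair \<open>(i, j)\<close> stands for the variable \<open>x\<^sub>i\<^sub>,\<^sub>j\<close> of \<open>A\<close>.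
  Only the values of \<open>a\<close> and \<open>b\<close> on \<open>{1..n}\<close> matter.\<close>

definition xvars :: "nat \<Rightarrow> (nat \<Rightarrow> nat) \<Rightarrow> (nat \<times> nat) set" where
  "xvars n a = (SIGMA i:{1..n}. {0..a i})"

definition multidegree :: "(nat \<times> nat) monomial \<Rightarrow> nat \<Rightarrow> int" where
  "multidegree m i = (\<Sum>v\<in>{v\<in>Poly_Mapping.keys m. fst v = i}. int (Poly_Mapping.lookup m v))"

definition multigraded_component ::
    "(nat \<Rightarrow> int) \<Rightarrow> (nat \<times> nat, 'k::field) mpoly \<Rightarrow> (nat \<times> nat, 'k) mpoly" where
  "multigraded_component d p =
     (\<Sum>m\<in>{m\<in>Poly_Mapping.keys p. multidegree m = d}.
        Poly_Mapping.single m (Poly_Mapping.lookup p m))"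

definition multigraded :: "(nat \<times> nat, 'k::field) mpoly set \<Rightarrow> bool" where
  "multigraded I \<longleftrightarrow> (\<forall>p\<in>I. \<forall>d. multigraded_component d p \<in> I)"

text \<open>The pair \<open>(i, \<alpha>)\<close> stands for the variable \<open>z\<^sub>i\<^sub>,\<^sub>\<alpha>\<close> of \<open>S\<close>; the exponent vector
  \<open>\<alpha> = (\<alpha>\<^sub>0, \<dots>, \<alpha>\<^sub>a)\<close>, where \<open>a = a i\<close>, is a finitely supported function vanishing outside
  \<open>{0..a i}\<close>.\<close>

definition zvars :: "nat \<Rightarrow> (nat \<Rightarrow> nat) \<Rightarrow> (nat \<Rightarrow> nat) \<Rightarrow> (nat \<times> (nat \<Rightarrow>\<^sub>0 nat)) set" where
  "zvars n a b =
     (SIGMA i:{1..n}. {\<alpha>. Poly_Mapping.keys \<alpha> \<subseteq> {0..a i} \<and>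
        (\<Sum>j\<in>{0..a i}. Poly_Mapping.lookup \<alpha> j) = b i})"

definition scroll_monomial ::
    "(nat \<Rightarrow> nat) \<Rightarrow> nat \<times> (nat \<Rightarrow>\<^sub>0 nat) \<Rightarrow> (nat \<times> nat, 'k::field) mpoly" where
  "scroll_monomial a = (\<lambda>(i, \<alpha>). \<Prod>j\<in>{0..a i}. mvar (i, j) ^ Poly_Mapping.lookup \<alpha> j)"

definition scroll_ideal ::
    "nat \<Rightarrow> (nat \<Rightarrow> nat) \<Rightarrow> (nat \<Rightarrow> nat) \<Rightarrow> (nat \<times> nat, 'k::field) mpoly set \<Rightarrow>
      (nat \<times> (nat \<Rightarrow>\<^sub>0 nat), 'k) mpoly set" where
  "scroll_ideal n a b I =
     a_kernel (mpoly_ring (zvars n a b)) (mpoly_ring (xvars n a) Quot I)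
       (\<lambda>p. I +>\<^bsub>mpoly_ring (xvars n a)\<^esub> mpoly_subst (scroll_monomial a) p)"

end

theory Submission
  imports Defs "HOL-Library.Product_Lexorder"
begin

text \<open>
  Write \<open>\<phi>\<close> for the map of monomials induced by \<open>S \<rightarrow> A\<close>, let \<open>J\<close> be the ideal of the scroll, that is
  the preimage of \<open>I\<close>, and call the set of monomials of \<open>S\<close> with a given image a fibre. Monomials of
  \<open>S\<close> are compared first by their images under the given order on \<open>A\<close> and then, within a fibre, by
  a weight (\<open>scroll_order\<close>). Let \<open>m\<close> be the leading monomial of some \<open>h \<in> J\<close>. There are two cases
  (\<open>leading_monomial_scroll\<close>).

  If \<open>\<phi>(m)\<close> is the leading monomial of an element of \<open>I\<close>, it is divisible by the leading monomial \<open>g\<close> of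
  an element of the given Groebner basis. Each variable of \<open>g\<close> divides the image of some factor of \<open>m\<close>,
  so a divisor \<open>m'\<close> of \<open>m\<close> with at most \<open>deg g\<close> factors satisfies \<open>g | \<phi>(m')\<close>, and \<open>m'\<close> can be
  taken squarefree if \<open>g\<close> is (\<open>covering_divisor\<close>). As \<open>I\<close> is multigraded, it contains a multihomogeneous
  polynomial with leading monomial \<open>\<phi>(m')\<close>. All its monomials are images of monomials of the degree of
  \<open>m'\<close>, and lifting them gives a form in \<open>J\<close> with leading monomial \<open>m'\<close> (\<open>form_lift\<close>).

  Otherwise the coefficient of \<open>\<phi>(m)\<close> in the image of \<open>h\<close> cancels, so \<open>m\<close> is not the least element of
  its fibre. It remains to choose the weight so that such an \<open>m\<close> is divisible by a product of two
  distinct variables that is not least in its fibre either; the binomial of this product and a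
  smaller element of its fibre then lies in \<open>J\<close>. For \<open>n = 1\<close> this is the theorem that Veronese ideals
  have squarefree quadratic initial ideals. The weight used is the sum, over the factors
  \<open>z\<^sub>i\<^sub>,\<^sub>\<alpha>\<close> and over all intervals \<open>{l..<h}\<close>, of the square of the sum of the entries of \<open>\<alpha>\<close> in that
  interval. If two factors with the same \<open>i\<close> have sums over some interval that differ by at least two,
  then redistributing their exponents by halving prefix sums lowers the weight (\<open>rebalance\<close>). If no
  two factors do, then all these square sums are simultaneously minimal in the fibre, and the
  monomial is the only one with this property (\<open>two_valued_unique\<close>, \<open>unbalanced_pair\<close>).
\<close>

abbreviation lookup where "lookup \<equiv> Poly_Mapping.lookup"
abbreviation keys where "keys \<equiv> Poly_Mapping.keys"
abbreviation single where "single \<equiv> Poly_Mapping.single"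

section \<open>Additive functions of monomials\<close>

text \<open>Every numerical invariant of monomials used below (total degree, multidegree, the exponents of
  the image monomial, the tie-breaking weight) is additive, hence of this one form.\<close>

definition weight :: "('v \<Rightarrow> 'c::comm_semiring_1) \<Rightarrow> 'v monomial \<Rightarrow> 'c" where
  "weight w m = (\<Sum>v\<in>keys m. of_nat (lookup m v) * w v)"

lemma weight_superset:
  assumes "finite A" "keys m \<subseteq> A"
  shows "weight w m = (\<Sum>v\<in>A. of_nat (lookup m v) * w v)"
  unfolding weight_def using assms
  by (intro sum.mono_neutral_left) (auto simp: in_keys_iff)

lemma weight_zero [simp]: "weight w 0 = 0"
  by (simp add: weight_def)

lemma weight_single [simp]: "weight w (single v k) = of_nat k * w v"
  by (simp add: weight_def)

lemma weight_plus: "weight w (s + t) = weight w s + weight w t"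
proof -
  let ?A = "keys s \<union> keys t"
  have "keys (s + t) \<subseteq> ?A" by (rule keys_add)
  then have "weight w (s + t) = (\<Sum>v\<in>?A. of_nat (lookup (s + t) v) * w v)"
    by (intro weight_superset) auto
  also have "\<dots> = (\<Sum>v\<in>?A. of_nat (lookup s v) * w v) + (\<Sum>v\<in>?A. of_nat (lookup t v) * w v)"
    by (simp add: lookup_add algebra_simps sum.distrib)
  finally show ?thesis by (simp add: weight_superset[of ?A])
qed

lemma weight_fun_sum: "weight (\<lambda>v. \<Sum>x\<in>B. w x v) m = (\<Sum>x\<in>B. weight (w x) m)"
  unfolding weight_def by (simp add: sum_distrib_left) (rule sum.swap)

lemma weight_of_nat: "of_nat (weight w m) = weight (\<lambda>v. of_nat (w v)) m"
  by (simp add: weight_def)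

lemma weight_cong: "(\<And>v. v \<in> keys m \<Longrightarrow> w v = w' v) \<Longrightarrow> weight w m = weight w' m"
  by (simp add: weight_def)

lemma weight_linear:
  fixes c d :: "'c::comm_semiring_1"
  shows "weight (\<lambda>v. f v + c * g v) m = weight f m + c * weight g m"
  by (simp add: weight_def algebra_simps sum.distrib sum_distrib_left)

lemma weight_nonneg:
  fixes w :: "'v \<Rightarrow> 'c::linordered_semidom"
  assumes "\<And>v. v \<in> keys m \<Longrightarrow> 0 \<le> w v"
  shows "0 \<le> weight w m"
  unfolding weight_def using assms by (intro sum_nonneg) auto

lemma weight_eq_0D:
  fixes w :: "'v \<Rightarrow> 'c::linordered_semidom"
  assumes "weight w m = 0" "\<And>v. v \<in> keys m \<Longrightarrow> 0 \<le> w v" "v \<in> keys m"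
  shows "w v = 0"
proof -
  have "\<forall>v\<in>keys m. of_nat (lookup m v) * w v = 0"
    using assms(1,2) unfolding weight_def by (subst (asm) sum_nonneg_eq_0_iff) auto
  with assms(3) show ?thesis by (auto simp: in_keys_iff)
qed

lemma weight_mono:
  fixes w :: "'v \<Rightarrow> 'c::linordered_semidom"
  assumes "\<And>v. v \<in> keys m \<Longrightarrow> w v \<le> w' v"
  shows "weight w m \<le> weight w' m"
  unfolding weight_def using assms by (intro sum_mono mult_left_mono) auto

lemma weight_strict_mono:
  fixes w :: "'v \<Rightarrow> 'c::linordered_semidom"
  assumes "\<And>v. v \<in> keys m \<Longrightarrow> w v \<le> w' v" "v0 \<in> keys m" "w v0 < w' v0"
  shows "weight w m < weight w' m"
  unfolding weight_def
proof (rule sum_strict_mono_ex1)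
  show "\<exists>v\<in>keys m. of_nat (lookup m v) * w v < of_nat (lookup m v) * w' v"
    using assms(2,3) by (intro bexI[of _ v0] mult_strict_left_mono) (auto simp: in_keys_iff)
qed (use assms in \<open>auto intro!: mult_left_mono\<close>)

lemma total_degree_weight: "total_degree m = weight (\<lambda>_. 1) m"
  by (simp add: total_degree_def weight_def)

lemma total_degree_plus: "total_degree (s + t) = total_degree s + total_degree t"
  by (simp add: total_degree_weight weight_plus)

lemma total_degree_single [simp]: "total_degree (single v k) = k"
  by (simp add: total_degree_weight)

lemma total_degree_0 [simp]: "total_degree 0 = 0"
  by (simp add: total_degree_weight)


section \<open>Monomials\<close>

lemma keys_plus_nat: "keys (s + t :: 'v monomial) = keys s \<union> keys t"
  by (auto simp: in_keys_iff lookup_add)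

lemma monomials_plus [simp]: "s + t \<in> monomials V \<longleftrightarrow> s \<in> monomials V \<and> t \<in> monomials V"
  by (simp add: monomials_def keys_plus_nat)

lemma monomials_zero [simp]: "0 \<in> monomials V"
  by (simp add: monomials_def)

lemma monomials_single [simp]: "k > 0 \<Longrightarrow> single v k \<in> monomials V \<longleftrightarrow> v \<in> V"
  by (simp add: monomials_def)

text \<open>Divisibility of monomials is written as \<open>t = u + s\<close> throughout, since monomials form an additive
  monoid of exponent vectors.\<close>

lemma monomial_divides:
  fixes s t :: "'v monomial"
  assumes "\<And>v. lookup s v \<le> lookup t v"
  obtains u where "t = u + s"
proof
  show "t = (t - s) + s"
    using assms by (intro poly_mapping_eqI) (simp add: lookup_add lookup_minus)
qed

lemma finite_monomials_total_degree_le: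
  assumes "finite V"
  shows "finite {m \<in> monomials V. total_degree m \<le> d}"
proof (rule inj_on_finite[of lookup])
  show "inj_on lookup {m \<in> monomials V. total_degree m \<le> d}"
    by (rule inj_onI) (simp add: poly_mapping_eqI)
  show "lookup ` {m \<in> monomials V. total_degree m \<le> d}
      \<subseteq> {f. \<forall>x. (x \<in> V \<longrightarrow> f x \<in> {..d}) \<and> (x \<notin> V \<longrightarrow> f x = 0)}"
  proof clarsimp
    fix m :: "'a monomial" and x assume m: "m \<in> monomials V" "total_degree m \<le> d"
    have "lookup m x \<le> total_degree m"
    proof (cases "x \<in> keys m")
      case True
      then show ?thesis unfolding total_degree_def by (intro member_le_sum) auto
    qed (simp add: in_keys_iff)
    with m show "(x \<in> V \<longrightarrow> lookup m x \<le> d) \<and> (x \<notin> V \<longrightarrow> lookup m x = 0)"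
      by (auto simp: monomials_def in_keys_iff)
  qed
  show "finite {f. \<forall>x. (x \<in> V \<longrightarrow> f x \<in> {..d}) \<and> (x \<notin> V \<longrightarrow> f x = (0::nat))}"
    using assms by (intro finite_set_of_finite_funs) auto
qed

lemma monomial_induct [case_names zero plus]:
  fixes m :: "'v monomial"
  assumes "P 0" "\<And>m v. P m \<Longrightarrow> P (m + single v 1)"
  shows "P m"
proof (induction "total_degree m" arbitrary: m)
  case 0
  have "lookup m v = 0" for v using 0 by (cases "v \<in> keys m") (auto simp: total_degree_def in_keys_iff)
  then have "m = 0" by (intro poly_mapping_eqI) simp
  then show ?case using assms(1) by simp
next
  case (Suc d)
  then have "m \<noteq> 0" by auto
  then obtain v where v: "lookup m v > 0"
    by (metis gr0I lookup_zero poly_mapping_eqI)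
  obtain u where u: "m = u + single v 1"
    by (rule monomial_divides[of "single v 1" m]) (use v in \<open>auto simp: lookup_single when_def\<close>)
  with Suc have "P u" by (simp add: total_degree_plus)
  with u assms(2) show ?case by simp
qed

lemma divisor_of_total_degree:
  assumes "d \<le> total_degree (m :: 'v monomial)"
  obtains s u where "m = u + s" "total_degree s = d"
proof -
  have "d \<le> total_degree m \<Longrightarrow> \<exists>s u. m = u + s \<and> total_degree s = d"
  proof (induction m rule: monomial_induct)
    case zero
    then show ?case by (auto intro: exI[of _ 0])
  next
    case (plus m v)
    show ?case
    proof (cases "d \<le> total_degree m")
      case True
      with plus.IH obtain s u where "m = u + s" "total_degree s = d" by blast
      then have "m + single v 1 = (u + single v 1) + s" by (simp add: ac_simps)
      with \<open>total_degree s = d\<close> show ?thesis by blast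
    next
      case False
      with plus.prems have "total_degree (m + single v 1) = d" by (simp add: total_degree_plus)
      moreover have "m + single v 1 = 0 + (m + single v 1)" by simp
      ultimately show ?thesis by blast
    qed
  qed
  with assms that show ?thesis by blast
qed


section \<open>Leading monomials and Groebner bases\<close>

lemma mpoly_ring_simps [simp]:
  "carrier (mpoly_ring V) = {p. keys p \<subseteq> monomials V}"
  "x \<otimes>\<^bsub>mpoly_ring V\<^esub> y = x * y"
  "x \<oplus>\<^bsub>mpoly_ring V\<^esub> y = x + y"
  "\<zero>\<^bsub>mpoly_ring V\<^esub> = 0"
  "\<one>\<^bsub>mpoly_ring V\<^esub> = 1"
  by (simp_all add: mpoly_ring_def)

lemma a_inv_mpoly_ring:
  fixes x :: "('v, 'k::field) mpoly"
  assumes "ring (mpoly_ring V :: ('v, 'k) mpoly ring)" "keys x \<subseteq> monomials V"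
  shows "\<ominus>\<^bsub>mpoly_ring V\<^esub> x = - x"
proof -
  interpret ring "mpoly_ring V :: ('v, 'k) mpoly ring" by fact
  show ?thesis
    by (rule minus_equality) (use assms in auto)
qed

lemma term_orderD:
  assumes "term_order V r"
  shows "\<And>s. s \<in> monomials V \<Longrightarrow> (s, s) \<in> r"
    and "\<And>s t u. (s, t) \<in> r \<Longrightarrow> (t, u) \<in> r \<Longrightarrow> (s, u) \<in> r"
    and "\<And>s t. (s, t) \<in> r \<Longrightarrow> (t, s) \<in> r \<Longrightarrow> s = t"
    and "\<And>s t. s \<in> monomials V \<Longrightarrow> t \<in> monomials V \<Longrightarrow> (s, t) \<in> r \<or> (t, s) \<in> r"
    and "\<And>s t u. s \<in> monomials V \<Longrightarrow> t \<in> monomials V \<Longrightarrow> u \<in> monomials V \<Longrightarrow> (s, t) \<in> r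
      \<Longrightarrow> (u + s, u + t) \<in> r"
    and "\<And>t. t \<in> monomials V \<Longrightarrow> (0, t) \<in> r"
  using assms unfolding term_order_def linear_order_on_def partial_order_on_def preorder_on_def
  apply (auto simp: refl_on_def add.commute dest: transD antisymD)
  by (metis (full_types) total_on_def)

lemma leading_monomial_eqI:
  assumes "term_order V r" "m \<in> keys p" "\<And>m'. m' \<in> keys p \<Longrightarrow> (m', m) \<in> r"
  shows "leading_monomial r p = m"
  unfolding leading_monomial_def
  by (rule the_equality) (use assms term_orderD(3)[OF assms(1)] in blast)+

lemma finite_set_has_greatest:
  assumes "term_order V r" "finite A" "A \<noteq> {}" "A \<subseteq> monomials V"
  shows "\<exists>m\<in>A. \<forall>m'\<in>A. (m', m) \<in> r"
  using assms(2,3,4)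
proof (induction A rule: finite_ne_induct)
  case (singleton x)
  then show ?case using term_orderD(1)[OF assms(1)] by auto
next
  case (insert x A)
  then obtain m where m: "m \<in> A" "\<forall>m'\<in>A. (m', m) \<in> r" by auto
  with insert.prems have mx: "m \<in> monomials V" "x \<in> monomials V" by auto
  note refl = term_orderD(1)[OF assms(1)]
  from term_orderD(4)[OF assms(1) mx] show ?case
  proof
    assume "(m, x) \<in> r"
    then have "\<forall>m'\<in>A. (m', x) \<in> r" using m term_orderD(2)[OF assms(1)] by blast
    with refl[OF mx(2)] show ?thesis by auto
  next
    assume "(x, m) \<in> r"
    with m show ?thesis by auto
  qed
qed

lemma leading_monomial:
  assumes "term_order V r" "p \<noteq> 0" "keys p \<subseteq> monomials V"
  shows "leading_monomial r p \<in> keys p"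
    and "m \<in> keys p \<Longrightarrow> (m, leading_monomial r p) \<in> r"
proof -
  have "keys p \<noteq> {}" using assms(2) by (metis in_keys_iff empty_iff lookup_zero poly_mapping_eqI)
  then obtain l where l: "l \<in> keys p" "\<forall>m'\<in>keys p. (m', l) \<in> r"
    using finite_set_has_greatest[OF assms(1) _ _ assms(3)] by auto
  then have "leading_monomial r p = l" by (intro leading_monomial_eqI[OF assms(1)]) auto
  with l show "leading_monomial r p \<in> keys p" "m \<in> keys p \<Longrightarrow> (m, leading_monomial r p) \<in> r"
    by auto
qed

lemma lookup_single_times:
  fixes p :: "('v, 'k::field) mpoly"
  shows "lookup (single u 1 * p) (u + s) = lookup p s"
proof -
  have "u + s = u + q \<longleftrightarrow> s = q" for q by auto
  then show ?thesis
    by (simp add: lookup_mult lookup_single when_mult Sum_any_when_independent)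
qed

lemma keys_single_times:
  fixes p :: "('v, 'k::field) mpoly"
  shows "keys (single u 1 * p) = (+) u ` keys p"
proof -
  have "keys (single u 1 * p) \<subseteq> (+) u ` keys p"
    using keys_mult[of "single u 1" p] by auto
  then show ?thesis by (auto simp: in_keys_iff lookup_single_times)
qed

lemma leading_monomial_single_times:
  fixes p :: "('v, 'k::field) mpoly"
  assumes "term_order V r" "p \<noteq> 0" "keys p \<subseteq> monomials V" "u \<in> monomials V"
  shows "leading_monomial r (single u 1 * p) = u + leading_monomial r p"
proof (rule leading_monomial_eqI[OF assms(1)])
  show "u + leading_monomial r p \<in> keys (single u 1 * p)"
    using leading_monomial(1)[OF assms(1-3)] by (auto simp: keys_single_times)
next
  fix m' assume "m' \<in> keys (single u 1 * p)"
  then show "(m', u + leading_monomial r p) \<in> r"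
    using leading_monomial[OF assms(1-3)] term_orderD(5)[OF assms(1)] assms(3,4)
    by (auto simp: keys_single_times subset_iff)
qed

text \<open>The ideal generated by a set \<open>L\<close> of monomials is contained in this one, which is what detects that
  a monomial of that ideal is a multiple of an element of \<open>L\<close>.\<close>

lemma multiples_ideal:
  assumes ring: "ring (mpoly_ring V :: ('v, 'k::field) mpoly ring)"
  shows "ideal {p. keys p \<subseteq> monomials V \<and> (\<forall>m\<in>keys p. \<exists>l\<in>L. \<exists>u. m = u + l)}
    (mpoly_ring V :: ('v, 'k) mpoly ring)" (is "ideal ?D _")
proof (rule idealI[OF ring])
  interpret ring "mpoly_ring V :: ('v, 'k) mpoly ring" by fact
  have minus: "keys (- x) = keys x" for x :: "('v, 'k) mpoly" by (auto simp: in_keys_iff)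
  show "subgroup ?D (add_monoid (mpoly_ring V))"
  proof (rule add.subgroupI)
    show "?D \<noteq> {}" by (auto intro!: exI[of _ 0])
    show "\<ominus>\<^bsub>mpoly_ring V\<^esub> x \<in> ?D" if "x \<in> ?D" for x
      using that by (auto simp: a_inv_mpoly_ring[OF ring] minus)
    show "x \<oplus>\<^bsub>mpoly_ring V\<^esub> y \<in> ?D" if "x \<in> ?D" "y \<in> ?D" for x y
      using that keys_add[of x y] by (auto simp: subset_iff)
  qed auto
  have key: "x * y \<in> ?D" if "y \<in> ?D" "keys x \<subseteq> monomials V" for x y
  proof -
    have "m \<in> monomials V \<and> (\<exists>l\<in>L. \<exists>u. m = u + l)" if "m \<in> keys (x * y)" for m
    proof -
      from that keys_mult[of x y] obtain s t where st: "s \<in> keys x" "t \<in> keys y" "m = s + t" by blast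
      with \<open>y \<in> ?D\<close> obtain l u where "l \<in> L" "t = u + l" by blast
      with st have "m = (s + u) + l" by (simp add: ac_simps)
      with \<open>l \<in> L\<close> have "\<exists>l\<in>L. \<exists>u. m = u + l" by blast
      moreover have "m \<in> monomials V"
        using st \<open>y \<in> ?D\<close> \<open>keys x \<subseteq> monomials V\<close> by auto
      ultimately show ?thesis by blast
    qed
    then show ?thesis by auto
  qed
  show "x \<otimes>\<^bsub>mpoly_ring V\<^esub> y \<in> ?D" if "y \<in> ?D" "x \<in> carrier (mpoly_ring V)" for x y
    using key[of y x] that by simp
  show "y \<otimes>\<^bsub>mpoly_ring V\<^esub> x \<in> ?D" if "y \<in> ?D" "x \<in> carrier (mpoly_ring V)" for x y
    using key[of y x] that by (simp add: mult.commute)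
qed

lemma groebner_basis_divides:
  fixes I :: "('v, 'k::field) mpoly set"
  assumes "term_order V r" "ideal I (mpoly_ring V)" "groebner_basis V r I G" "f \<in> I" "f \<noteq> 0"
  obtains g u where "g \<in> G" "leading_monomial r f = u + leading_monomial r g"
proof -
  interpret ideal I "mpoly_ring V :: ('v, 'k) mpoly ring" by fact
  let ?L = "leading_monomial r ` G"
  let ?D = "{p :: ('v, 'k) mpoly. keys p \<subseteq> monomials V \<and> (\<forall>m\<in>keys p. \<exists>l\<in>?L. \<exists>u. m = u + l)}"
  have G: "G \<subseteq> I - {0}" using assms(3) by (simp add: groebner_basis_def)
  have IV: "keys p \<subseteq> monomials V" if "p \<in> I" for p using that a_subset by auto
  have "single (leading_monomial r f) 1 \<in> initial_ideal V r I"
    unfolding initial_ideal_def genideal_def using assms(4,5) by auto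
  also have "\<dots> = initial_ideal V r G"
    using assms(3) by (simp add: groebner_basis_def)
  also have "\<dots> \<subseteq> ?D"
  proof -
    have "single (leading_monomial r p) 1 \<in> ?D" if "p \<in> G" for p
    proof -
      have "p \<in> I" "p \<noteq> 0" using that G by auto
      then have "leading_monomial r p \<in> keys p" "keys p \<subseteq> monomials V"
        using leading_monomial(1)[OF assms(1)] IV by auto
      moreover have "\<exists>l\<in>?L. \<exists>u. leading_monomial r p = u + l"
        using that by (intro bexI[of _ "leading_monomial r p"] exI[of _ 0]) simp_all
      ultimately show ?thesis by auto
    qed
    then have "(\<lambda>p. single (leading_monomial r p) 1) ` (G - {0}) \<subseteq> ?D" by blast
    then show ?thesis
      unfolding initial_ideal_def genideal_def
      using multiples_ideal[OF ring_axioms, of ?L] by (intro Inter_lower CollectI conjI)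
  qed
  finally show ?thesis using that by auto
qed

text \<open>If an ideal contains the leading monomial of \<open>h\<close>, it contains all its multiples; so divisibility of
  leading monomials already gives the inclusion of initial ideals, for any set \<open>J\<close> of polynomials.\<close>

lemma groebner_basisI:
  fixes J :: "('v, 'k::field) mpoly set"
  assumes "term_order V r" "finite H" "H \<subseteq> J - {0}" "\<And>f. f \<in> J \<Longrightarrow> keys f \<subseteq> monomials V"
    and div: "\<And>f. f \<in> J \<Longrightarrow> f \<noteq> 0 \<Longrightarrow> \<exists>h\<in>H. \<exists>u. leading_monomial r f = u + leading_monomial r h"
  shows "groebner_basis V r J H"
proof -
  have "single (leading_monomial r f) 1 \<in> K"
    if K: "ideal K (mpoly_ring V)" "(\<lambda>p. single (leading_monomial r p) 1) ` (H - {0}) \<subseteq> K"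
      and f: "f \<in> J - {0}" for K :: "('v, 'k) mpoly set" and f
  proof -
    from div f obtain h u where h: "h \<in> H" "leading_monomial r f = u + leading_monomial r h" by blast
    have "leading_monomial r f \<in> monomials V"
      using leading_monomial(1)[OF assms(1)] assms(4) f by blast
    with h have "u \<in> monomials V" by simp
    moreover have "single (leading_monomial r h) 1 \<in> K" using h K assms(3) by auto
    ultimately have "single u 1 * single (leading_monomial r h) 1 \<in> K"
      using ideal.I_l_closed[OF K(1), of "single (leading_monomial r h) 1" "single u 1"] by simp
    then show ?thesis by (simp add: mult_single h)
  qed
  then have "initial_ideal V r J \<subseteq> initial_ideal V r H"
    unfolding initial_ideal_def genideal_def by blast
  moreover have "initial_ideal V r H \<subseteq> initial_ideal V r J"
    unfolding initial_ideal_def genideal_def using assms(3) by blast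
  ultimately show ?thesis using assms by (simp add: groebner_basis_def)
qed


section \<open>The monomial map of the scroll\<close>

text \<open>The inner sum is \<open>e v\<close> added to itself \<open>lookup m v\<close> times, so \<open>monomial_map e\<close> is the homomorphism
  of monomials that sends the variable \<open>v\<close> to \<open>e v\<close>.\<close>

definition monomial_map :: "('v \<Rightarrow> 'w monomial) \<Rightarrow> 'v monomial \<Rightarrow> 'w monomial" where
  "monomial_map e m = (\<Sum>v\<in>keys m. \<Sum>_<lookup m v. e v)"

lemma lookup_monomial_map: "lookup (monomial_map e m) x = weight (\<lambda>v. lookup (e v) x) m"
  by (simp add: monomial_map_def lookup_sum weight_def)

lemma monomial_map_plus: "monomial_map e (s + t) = monomial_map e s + monomial_map e t"
  by (rule poly_mapping_eqI) (simp add: lookup_monomial_map lookup_add weight_plus)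

lemma monomial_map_single [simp]: "monomial_map e (single v 1) = e v"
  by (rule poly_mapping_eqI) (simp add: lookup_monomial_map)

lemma monomial_map_zero [simp]: "monomial_map e 0 = 0"
  by (rule poly_mapping_eqI) (simp add: lookup_monomial_map)

definition scroll_exponent :: "nat \<times> (nat \<Rightarrow>\<^sub>0 nat) \<Rightarrow> (nat \<times> nat) monomial" where
  "scroll_exponent z = (\<Sum>j\<in>keys (snd z). single (fst z, j) (lookup (snd z) j))"

lemma lookup_scroll_exponent:
  "lookup (scroll_exponent z) x = (if fst x = fst z then lookup (snd z) (snd x) else 0)"
proof -
  have "lookup (scroll_exponent z) x
      = (\<Sum>j\<in>keys (snd z). if j = snd x \<and> fst x = fst z then lookup (snd z) j else 0)"
    unfolding scroll_exponent_def lookup_sum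
    by (intro sum.cong) (auto simp: lookup_single when_def prod_eq_iff)
  also have "\<dots> = (if fst x = fst z then lookup (snd z) (snd x) else 0)"
    by (cases "fst x = fst z") (auto simp: in_keys_iff)
  finally show ?thesis .
qed

abbreviation scroll_map :: "(nat \<times> (nat \<Rightarrow>\<^sub>0 nat)) monomial \<Rightarrow> (nat \<times> nat) monomial" where
  "scroll_map \<equiv> monomial_map scroll_exponent"

lemma scroll_map_in_monomials:
  assumes "m \<in> monomials (zvars n a b)"
  shows "scroll_map m \<in> monomials (xvars n a)"
proof -
  have "x \<in> xvars n a" if x: "x \<in> keys (scroll_map m)" for x
  proof (rule ccontr)
    assume nx: "x \<notin> xvars n a"
    have "lookup (scroll_exponent z) x = 0" if "z \<in> keys m" for z
    proof -
      have "z \<in> zvars n a b" using that assms by (auto simp: monomials_def)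
      then show ?thesis using nx
        by (cases x; cases z) (auto simp: lookup_scroll_exponent zvars_def xvars_def in_keys_iff subset_iff)
    qed
    then have "lookup (scroll_map m) x = weight (\<lambda>_. 0) m"
      unfolding lookup_monomial_map by (intro weight_cong)
    with x show False by (simp add: weight_def in_keys_iff)
  qed
  then show ?thesis by (auto simp: monomials_def)
qed


section \<open>Balancing the exponent vectors of a monomial\<close>

definition block :: "(nat \<Rightarrow>\<^sub>0 nat) \<Rightarrow> nat \<Rightarrow> nat \<Rightarrow> int" where
  "block \<alpha> l h = (\<Sum>t\<in>{l..<h}. int (lookup \<alpha> t))"

lemma block_prefix: "l \<le> h \<Longrightarrow> block \<alpha> l h = block \<alpha> 0 h - block \<alpha> 0 l"
  using sum.atLeastLessThan_concat[of 0 l h "\<lambda>t. int (lookup \<alpha> t)"] by (simp add: block_def)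

lemma zvars_block:
  assumes "z \<in> zvars n a b"
  shows "block (snd z) 0 (Suc (a (fst z))) = int (b (fst z))"
  using assms by (auto simp: zvars_def block_def atLeastLessThanSuc_atLeastAtMost simp flip: of_nat_sum)

text \<open>With \<open>\<alpha>(J)\<close> the sum of the entries of \<open>\<alpha>\<close> over an interval \<open>J\<close>, this is the sum of the squares
  \<open>\<alpha>(J)\<^sup>2\<close>. Since it is strictly convex in each \<open>\<alpha>(J)\<close>, it penalises a monomial of \<open>S\<close> whose factors
  distribute their exponents unevenly. Taking all intervals, and not only the single entries, is
  what makes the minimiser in a fibre unique.\<close>

definition spread :: "(nat \<Rightarrow> nat) \<Rightarrow> nat \<times> (nat \<Rightarrow>\<^sub>0 nat) \<Rightarrow> int" where
  "spread a z = (\<Sum>h\<le>Suc (a (fst z)). \<Sum>l\<le>h. (block (snd z) l h)\<^sup>2)"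

text \<open>Used with \<open>s\<close> the prefix sums of \<open>\<alpha> + \<beta>\<close> and \<open>c = 0, 1\<close>, this splits \<open>\<alpha> + \<beta>\<close> into two exponent
  vectors whose prefix sums are the halves of \<open>s\<close> rounded down and up. Rounding is monotone, so the
  differences of the halved prefix sums are again natural numbers.\<close>

lemma halved_prefix_sums:
  fixes s :: "nat \<Rightarrow> nat"
  assumes "mono s" "s 0 = 0" "\<And>j. j > A \<Longrightarrow> s j = 2 * B" "c \<le> 1"
  obtains \<gamma> where "keys \<gamma> \<subseteq> {0..A}" "(\<Sum>j\<in>{0..A}. lookup \<gamma> j) = B"
    "\<And>j. block \<gamma> 0 j = int ((s j + c) div 2)"
proof
  define f where "f t = (s (Suc t) + c) div 2 - (s t + c) div 2" for t
  define \<gamma> where "\<gamma> = (\<Sum>t\<in>{0..A}. single t (f t))"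
  have f0: "f t = 0" if "t > A" for t using that assms(3) by (simp add: f_def)
  have lookup: "lookup \<gamma> t = f t" for t
    using f0[of t] by (cases "t \<le> A") (auto simp: \<gamma>_def lookup_sum lookup_single when_def)
  show "keys \<gamma> \<subseteq> {0..A}" 
    by (rule subsetI) (use f0 lookup in \<open>auto simp: in_keys_iff not_less[symmetric]\<close>)
  have step: "(s t + c) div 2 \<le> (s (Suc t) + c) div 2" for t
    using monoD[OF assms(1), of t "Suc t"] by (intro div_le_mono) simp
  show block: "block \<gamma> 0 j = int ((s j + c) div 2)" for j
  proof (induction j)
    case 0
    then show ?case using assms(2,4) by (simp add: block_def)
  next
    case (Suc j)
    have "block \<gamma> 0 (Suc j) = block \<gamma> 0 j + int (f j)" by (simp add: block_def lookup)
    with Suc step[of j] show ?case by (simp add: f_def of_nat_diff)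
  qed
  have "int (\<Sum>j\<in>{0..A}. lookup \<gamma> j) = block \<gamma> 0 (Suc A)"
    by (simp add: block_def atLeastLessThanSuc_atLeastAtMost)
  also have "\<dots> = int B" using assms(3)[of "Suc A"] assms(4) by (simp add: block)
  finally show "(\<Sum>j\<in>{0..A}. lookup \<gamma> j) = B" by (simp only: of_nat_eq_iff)
qed

lemma sum_squares_le:
  fixes x y u v :: int
  assumes "x + y = u + v" "\<bar>u - v\<bar> \<le> 1"
  shows "u\<^sup>2 + v\<^sup>2 \<le> x\<^sup>2 + y\<^sup>2" and "2 \<le> \<bar>x - y\<bar> \<Longrightarrow> u\<^sup>2 + v\<^sup>2 < x\<^sup>2 + y\<^sup>2"
proof -
  have e: "2 * (p\<^sup>2 + q\<^sup>2) = (p + q)\<^sup>2 + (p - q)\<^sup>2" for p q :: int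
    by (simp add: power2_eq_square algebra_simps)
  have "\<bar>u - v\<bar> \<le> \<bar>x - y\<bar>"
  proof (cases "x = y")
    case True
    with assms have "u = v" by presburger
    then show ?thesis by simp
  qed (use assms(2) in auto)
  then have "(u - v)\<^sup>2 \<le> (x - y)\<^sup>2" by (simp add: abs_le_square_iff)
  with e[of u v] e[of x y] assms(1) show "u\<^sup>2 + v\<^sup>2 \<le> x\<^sup>2 + y\<^sup>2" by simp
  assume "2 \<le> \<bar>x - y\<bar>"
  with assms(2) have "\<bar>u - v\<bar> < \<bar>x - y\<bar>" by simp
  then have "(u - v)\<^sup>2 < (x - y)\<^sup>2" by (meson abs_le_square_iff linorder_not_le)
  with e[of u v] e[of x y] assms(1) show "u\<^sup>2 + v\<^sup>2 < x\<^sup>2 + y\<^sup>2" by simp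
qed

text \<open>Replace \<open>\<alpha>\<close>, \<open>\<beta>\<close> by the two vectors whose prefix sums are the rounded halves of those of
  \<open>\<alpha> + \<beta>\<close>. Their sums over any interval then differ by at most one, which is the least possible for
  a given total; so no square sum grows, and the one over the interval with the gap drops.\<close>

lemma rebalance:
  assumes z: "(i, \<alpha>) \<in> zvars n a b" "(i, \<beta>) \<in> zvars n a b"
    and gap: "l \<le> h" "h \<le> Suc (a i)" "2 \<le> \<bar>block \<alpha> l h - block \<beta> l h\<bar>"
  obtains \<alpha>' \<beta>' where "(i, \<alpha>') \<in> zvars n a b" "(i, \<beta>') \<in> zvars n a b"
    "\<And>j. lookup \<alpha>' j + lookup \<beta>' j = lookup \<alpha> j + lookup \<beta> j"
    "spread a (i, \<alpha>') + spread a (i, \<beta>') < spread a (i, \<alpha>) + spread a (i, \<beta>)"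
proof -
  define s where "s j = (\<Sum>t<j. lookup \<alpha> t + lookup \<beta> t)" for j
  have i: "i \<in> {1..n}" and \<alpha>: "keys \<alpha> \<subseteq> {0..a i}" "(\<Sum>j\<in>{0..a i}. lookup \<alpha> j) = b i"
    and \<beta>: "keys \<beta> \<subseteq> {0..a i}" "(\<Sum>j\<in>{0..a i}. lookup \<beta> j) = b i"
    using z by (auto simp: zvars_def)
  have "mono s" unfolding s_def by (intro monoI sum_mono2) auto
  moreover have "s 0 = 0" by (simp add: s_def)
  moreover have "s j = 2 * b i" if "j > a i" for j
  proof -
    have "s j = (\<Sum>t\<in>{0..a i}. lookup \<alpha> t + lookup \<beta> t)"
      unfolding s_def using that \<alpha>(1) \<beta>(1)
      by (intro sum.mono_neutral_right) (auto simp: in_keys_iff subset_iff)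
    with \<alpha>(2) \<beta>(2) show ?thesis by (simp add: sum.distrib)
  qed
  ultimately have ex: "\<exists>\<gamma>. keys \<gamma> \<subseteq> {0..a i} \<and> (\<Sum>j\<in>{0..a i}. lookup \<gamma> j) = b i \<and>
      (\<forall>j. block \<gamma> 0 j = int ((s j + c) div 2))" if "c \<le> 1" for c
    using halved_prefix_sums[of s "a i" "b i" c] that by metis
  from ex[of 1] obtain \<alpha>' where \<alpha>': "keys \<alpha>' \<subseteq> {0..a i}" "(\<Sum>j\<in>{0..a i}. lookup \<alpha>' j) = b i"
    and block_\<alpha>': "\<And>j. block \<alpha>' 0 j = int ((s j + 1) div 2)" by auto
  from ex[of 0] obtain \<beta>' where \<beta>': "keys \<beta>' \<subseteq> {0..a i}" "(\<Sum>j\<in>{0..a i}. lookup \<beta>' j) = b i"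
    and block_\<beta>': "\<And>j. block \<beta>' 0 j = int (s j div 2)" by auto
  have prefix: "block \<alpha> 0 j + block \<beta> 0 j = int (s j)" for j
    by (simp add: block_def s_def sum.distrib lessThan_atLeast0)
  have halves: "(k + 1) div 2 + k div 2 = k" for k :: nat by presburger
  have prefix': "block \<alpha>' 0 j + block \<beta>' 0 j = int (s j)" for j
    unfolding block_\<alpha>' block_\<beta>' by (simp only: of_nat_add[symmetric] halves)
  have block_sum: "block \<alpha> p q + block \<beta> p q = block \<alpha>' p q + block \<beta>' p q" if "p \<le> q" for p q
    using prefix[of p] prefix[of q] prefix'[of p] prefix'[of q]
    by (simp add: block_prefix[OF that])
  have gap_le: "\<bar>block \<alpha>' p q - block \<beta>' p q\<bar> \<le> 1" if "p \<le> q" for p q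
    unfolding block_prefix[OF that] block_\<alpha>' block_\<beta>' by linarith
  have le: "(block \<alpha>' p q)\<^sup>2 + (block \<beta>' p q)\<^sup>2 \<le> (block \<alpha> p q)\<^sup>2 + (block \<beta> p q)\<^sup>2" if "p \<le> q" for p q
    by (rule sum_squares_le(1)[OF block_sum[OF that] gap_le[OF that]])
  show ?thesis
  proof
    show "(i, \<alpha>') \<in> zvars n a b" "(i, \<beta>') \<in> zvars n a b"
      using i \<alpha>' \<beta>' by (auto simp: zvars_def)
    show "lookup \<alpha>' j + lookup \<beta>' j = lookup \<alpha> j + lookup \<beta> j" for j
      using block_sum[of j "Suc j"] by (simp add: block_def flip: of_nat_add)
    have "(\<Sum>q\<le>Suc (a i). \<Sum>p\<le>q. (block \<alpha>' p q)\<^sup>2 + (block \<beta>' p q)\<^sup>2)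
        < (\<Sum>q\<le>Suc (a i). \<Sum>p\<le>q. (block \<alpha> p q)\<^sup>2 + (block \<beta> p q)\<^sup>2)"
    proof (rule sum_strict_mono_ex1)
      show "\<forall>q\<in>{..Suc (a i)}. (\<Sum>p\<le>q. (block \<alpha>' p q)\<^sup>2 + (block \<beta>' p q)\<^sup>2)
          \<le> (\<Sum>p\<le>q. (block \<alpha> p q)\<^sup>2 + (block \<beta> p q)\<^sup>2)"
        using le by (intro ballI sum_mono) auto
      have "(\<Sum>p\<le>h. (block \<alpha>' p h)\<^sup>2 + (block \<beta>' p h)\<^sup>2)
          < (\<Sum>p\<le>h. (block \<alpha> p h)\<^sup>2 + (block \<beta> p h)\<^sup>2)"
        using le gap(1) sum_squares_le(2)[OF block_sum[OF gap(1)] gap_le[OF gap(1)] gap(3)]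
        by (intro sum_strict_mono_ex1) auto
      with gap(2) show "\<exists>q\<in>{..Suc (a i)}. (\<Sum>p\<le>q. (block \<alpha>' p q)\<^sup>2 + (block \<beta>' p q)\<^sup>2)
          < (\<Sum>p\<le>q. (block \<alpha> p q)\<^sup>2 + (block \<beta> p q)\<^sup>2)" by auto
    qed auto
    then show "spread a (i, \<alpha>') + spread a (i, \<beta>') < spread a (i, \<alpha>) + spread a (i, \<beta>)"
      by (simp add: spread_def sum.distrib)
  qed
qed

text \<open>Each interval sum takes, over the factors with a given first index, at most two values, and these
  are consecutive. The lower values \<open>p\<close> are a parameter so that two monomials can be compared.\<close>

definition two_valued ::
    "(nat \<Rightarrow> nat) \<Rightarrow> (nat \<Rightarrow> nat \<Rightarrow> nat \<Rightarrow> int) \<Rightarrow> (nat \<times> (nat \<Rightarrow>\<^sub>0 nat)) monomial \<Rightarrow> bool" where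
  "two_valued a p m \<longleftrightarrow> (\<forall>z\<in>keys m. \<forall>h\<le>Suc (a (fst z)). \<forall>l\<le>h.
     block (snd z) l h \<in> {p (fst z) l h, p (fst z) l h + 1})"

text \<open>The total over all factors of an interval sum can be read off the image monomial, as the sum of
  exponents of the variables \<open>x\<^sub>i\<^sub>,\<^sub>t\<close> with \<open>t\<close> in the interval.\<close>

lemma fibre_weight_block:
  assumes "scroll_map s = scroll_map m"
  shows "weight (\<lambda>z. of_bool (fst z = i) * block (snd z) l h) s
    = weight (\<lambda>z. of_bool (fst z = i) * block (snd z) l h) m"
proof -
  have "weight (\<lambda>z. of_bool (fst z = i) * block (snd z) l h) m
      = (\<Sum>t\<in>{l..<h}. int (lookup (scroll_map m) (i, t)))" for m
  proof -
    have "(\<lambda>z. of_bool (fst z = i) * block (snd z) l h)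
        = (\<lambda>z. \<Sum>t\<in>{l..<h}. int (lookup (scroll_exponent z) (i, t)))"
      by (auto simp: fun_eq_iff block_def lookup_scroll_exponent)
    then show ?thesis by (simp add: weight_fun_sum lookup_monomial_map weight_of_nat)
  qed
  then show ?thesis by (simp add: assms)
qed

lemma weight_block_total:
  assumes "m \<in> monomials (zvars n a b)"
  shows "weight (\<lambda>z. of_bool (fst z = i) * block (snd z) 0 (Suc (a i))) m
    = int (b i) * weight (\<lambda>z. of_bool (fst z = i)) m"
proof -
  have "weight (\<lambda>z. of_bool (fst z = i) * block (snd z) 0 (Suc (a i))) m
      = weight (\<lambda>z. 0 + int (b i) * of_bool (fst z = i)) m"
    using assms zvars_block by (intro weight_cong) (force simp: monomials_def)
  also have "\<dots> = weight (\<lambda>_. 0) m + int (b i) * weight (\<lambda>z. of_bool (fst z = i)) m"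
    by (rule weight_linear)
  finally show ?thesis by (simp add: weight_def)
qed

text \<open>If two factors had prefix sums ordered one way at \<open>j\<close> and the other way at \<open>k\<close>, then their sums over
  the interval between \<open>j\<close> and \<open>k\<close> would differ by at least two. So the factors with a given first
  index form a chain for the pointwise order of prefix sums, and a chain has a greatest element.\<close>

lemma prefix_greatest:
  assumes "two_valued a p m" "z0 \<in> keys m"
  shows "\<exists>z\<in>keys m. fst z = fst z0 \<and>
    (\<forall>y\<in>keys m. fst y = fst z0 \<longrightarrow> (\<forall>j\<le>Suc (a (fst z0)). block (snd y) 0 j \<le> block (snd z) 0 j))"
proof -
  define i where "i = fst z0"
  define S where "S = {z \<in> keys m. fst z = i}"
  define f where "f z = (\<Sum>j\<le>Suc (a i). block (snd z) 0 j)" for z :: "nat \<times> (nat \<Rightarrow>\<^sub>0 nat)"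
  have S: "finite S" "z0 \<in> S" using assms(2) by (auto simp: S_def i_def)
  then have "Max (f ` S) \<in> f ` S" by (intro Max_in) auto
  then obtain z where z: "z \<in> S" "f z = Max (f ` S)" by auto
  then have max: "f y \<le> f z" if "y \<in> S" for y using that S by simp
  have "block (snd y) 0 j \<le> block (snd z) 0 j" if y: "y \<in> S" and j: "j \<le> Suc (a i)" for y j
  proof (rule ccontr)
    assume less: "\<not> block (snd y) 0 j \<le> block (snd z) 0 j"
    have "block (snd z) 0 k \<le> block (snd y) 0 k" if k: "k \<le> Suc (a i)" for k
    proof (rule ccontr)
      assume greater: "\<not> block (snd z) 0 k \<le> block (snd y) 0 k"
      have two: "block (snd x) q q' \<in> {p i q q', p i q q' + 1}"
        if "x \<in> S" "q \<le> q'" "q' \<le> Suc (a i)" for x q q'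
        using assms(1) that by (auto simp: two_valued_def S_def)
      show False
      proof (cases "j \<le> k")
        case True
        with two[OF y True k] two[OF z(1) True k] less greater show ?thesis
          by (auto simp: block_prefix[OF True])
      next
        case False
        then have kj: "k \<le> j" by simp
        with two[OF y kj j] two[OF z(1) kj j] less greater show ?thesis
          by (auto simp: block_prefix[OF kj])
      qed
    qed
    then have "f z < f y" unfolding f_def using less j
      by (intro sum_strict_mono_ex1) (auto simp: not_le)
    with max[OF y] show False by simp
  qed
  with z(1) show ?thesis by (auto simp: S_def i_def)
qed

context
  fixes n :: nat and a b :: "nat \<Rightarrow> nat"
  assumes b_pos: "\<forall>i\<in>{1..n}. 0 < b i"
begin

text \<open>The image has degree \<open>b\<^sub>i\<close> times the number of factors with first index \<open>i\<close>, and \<open>b\<^sub>i > 0\<close>.\<close>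

lemma fibre_weight_factors:
  assumes "s \<in> monomials (zvars n a b)" "m \<in> monomials (zvars n a b)" "scroll_map s = scroll_map m"
  shows "weight (\<lambda>z. of_bool (fst z = i)) s = (weight (\<lambda>z. of_bool (fst z = i)) m :: int)"
proof (cases "i \<in> {1..n}")
  case True
  then have "b i > 0" using b_pos by auto
  then show ?thesis
    using weight_block_total[OF assms(1), of i] weight_block_total[OF assms(2), of i]
      fibre_weight_block[OF assms(3), of i 0 "Suc (a i)"] by simp
next
  case False
  have "weight (\<lambda>z. of_bool (fst z = i)) m = weight (\<lambda>_. 0 :: int) m" if "m \<in> monomials (zvars n a b)" for m
    using that False by (intro weight_cong) (auto simp: monomials_def zvars_def subset_iff)
  from this[OF assms(1)] this[OF assms(2)] show ?thesis by (simp add: weight_def)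
qed

text \<open>If the greatest prefix sum were larger in \<open>m\<close> than in \<open>s\<close>, then all factors of \<open>s\<close> would take the
  lower of the two values and some factor of \<open>m\<close> the upper one; but the number of factors and the
  total of the prefix sums are the same for both.\<close>

lemma prefix_greatest_le:
  assumes sm: "s \<in> monomials (zvars n a b)" "m \<in> monomials (zvars n a b)" "scroll_map s = scroll_map m"
    and two: "two_valued a p s" "two_valued a p m"
    and z: "z \<in> keys m" and y: "y \<in> keys s" "fst y = fst z"
    and greatest: "\<And>x. x \<in> keys s \<Longrightarrow> fst x = fst z \<Longrightarrow> block (snd x) 0 j \<le> block (snd y) 0 j"
    and j: "j \<le> Suc (a (fst z))"
  shows "block (snd z) 0 j \<le> block (snd y) 0 j"
proof (rule ccontr)
  let ?i = "fst z" and ?c = "p (fst z) 0 j"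
  assume less: "\<not> ?thesis"
  have "block (snd z) 0 j \<in> {?c, ?c + 1}" using two(2) z j by (auto simp: two_valued_def)
  moreover have "block (snd y) 0 j \<in> {?c, ?c + 1}"
    using two(1) y j unfolding two_valued_def by (metis zero_le)
  ultimately have c: "block (snd y) 0 j = ?c" "block (snd z) 0 j > ?c" using less by auto
  have count: "weight (\<lambda>z. 0 + ?c * of_bool (fst z = ?i)) x
      = ?c * weight (\<lambda>z. of_bool (fst z = ?i)) x" for x :: "(nat \<times> (nat \<Rightarrow>\<^sub>0 nat)) monomial"
    unfolding weight_linear by (simp add: weight_def)
  have "weight (\<lambda>z. of_bool (fst z = ?i) * block (snd z) 0 j) s
      \<le> weight (\<lambda>z. 0 + ?c * of_bool (fst z = ?i)) s"
    using greatest c(1) by (intro weight_mono) auto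
  also have "\<dots> = weight (\<lambda>z. 0 + ?c * of_bool (fst z = ?i)) m"
    unfolding count by (simp add: fibre_weight_factors[OF sm])
  also have "\<dots> < weight (\<lambda>z. of_bool (fst z = ?i) * block (snd z) 0 j) m"
  proof (rule weight_strict_mono[OF _ z])
    fix v assume v: "v \<in> keys m"
    show "0 + ?c * of_bool (fst v = ?i) \<le> of_bool (fst v = ?i) * block (snd v) 0 j"
    proof (cases "fst v = ?i")
      case True
      then have "block (snd v) 0 j \<in> {?c, ?c + 1}"
        using two(2) v j unfolding two_valued_def by (metis zero_le)
      with True show ?thesis by auto
    qed simp
  qed (use c(2) in simp)
  finally show False using fibre_weight_block[OF sm(3), of ?i 0 j] by simp
qed

text \<open>By \<open>prefix_greatest\<close> and \<open>prefix_greatest_le\<close>, the latter in both directions, the greatest factors of \<open>s\<close> and \<open>m\<close> for some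
  first index have the same prefix sums, so they are the same variable; cancel it and induct.\<close>

lemma two_valued_unique:
  assumes "s \<in> monomials (zvars n a b)" "m \<in> monomials (zvars n a b)" "scroll_map s = scroll_map m"
    and "two_valued a p s" "two_valued a p m"
  shows "s = m"
  using assms
proof (induction "total_degree m" arbitrary: m s rule: less_induct)
  case less
  note sm = less.prems(1-3) and two = less.prems(4,5)
  have has: "\<exists>y\<in>keys s. fst y = fst z" if z: "z \<in> keys m"
    and sm: "s \<in> monomials (zvars n a b)" "m \<in> monomials (zvars n a b)" "scroll_map s = scroll_map m" for z s m
  proof (rule ccontr)
    assume "\<not> ?thesis"
    then have "weight (\<lambda>y. of_bool (fst y = fst z)) s = weight (\<lambda>_. 0 :: int) s"
      by (intro weight_cong) auto
    then have "weight (\<lambda>y. of_bool (fst y = fst z)) m = (0 :: int)"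
      using fibre_weight_factors[OF sm, of "fst z"] by (simp add: weight_def)
    from weight_eq_0D[OF this _ z] show False by simp
  qed
  show ?case
  proof (cases "keys m = {}")
    case True
    then have "keys s = {}" using has[OF _ sm(2,1) sm(3)[symmetric]] by blast
    with True show ?thesis
      by (intro poly_mapping_eqI) (metis empty_iff in_keys_iff)
  next
    case False
    then obtain z0 where z0: "z0 \<in> keys m" by blast
    define i where "i = fst z0"
    from has[OF z0 sm] obtain y0 where y0: "y0 \<in> keys s" "fst y0 = i" by (auto simp: i_def)
    from prefix_greatest[OF two(2) z0] obtain z where z: "z \<in> keys m" "fst z = i"
      and gz: "\<And>x j. x \<in> keys m \<Longrightarrow> fst x = i \<Longrightarrow> j \<le> Suc (a i) \<Longrightarrow> block (snd x) 0 j \<le> block (snd z) 0 j"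
      by (auto simp: i_def)
    from prefix_greatest[OF two(1) y0(1)] obtain y where y: "y \<in> keys s" "fst y = i"
      and gy: "\<And>x j. x \<in> keys s \<Longrightarrow> fst x = i \<Longrightarrow> j \<le> Suc (a i) \<Longrightarrow> block (snd x) 0 j \<le> block (snd y) 0 j"
      by (auto simp: y0(2))
    have eq: "block (snd z) 0 j = block (snd y) 0 j" if "j \<le> Suc (a i)" for j
    proof (rule antisym)
      show "block (snd z) 0 j \<le> block (snd y) 0 j"
        by (rule prefix_greatest_le[OF sm two z(1) y(1)]) (use y z gy that in auto)
      show "block (snd y) 0 j \<le> block (snd z) 0 j"
        by (rule prefix_greatest_le[OF sm(2,1) sm(3)[symmetric] two(2,1) y(1) z(1)])
          (use y z gz that in auto)
    qed
    have "z \<in> zvars n a b" "y \<in> zvars n a b" using sm y z by (auto simp: monomials_def)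
    have "lookup (snd z) j = lookup (snd y) j" for j
    proof (cases "j \<le> a i")
      case True
      have "block \<gamma> 0 (Suc j) = block \<gamma> 0 j + int (lookup \<gamma> j)" for \<gamma> by (simp add: block_def)
      with eq[of j] eq[of "Suc j"] True show ?thesis by simp
    next
      case False
      then have "j \<notin> keys (snd z)" "j \<notin> keys (snd y)"
        using \<open>z \<in> zvars n a b\<close> \<open>y \<in> zvars n a b\<close> y(2) z(2) by (auto simp: zvars_def)
      then show ?thesis by (simp add: in_keys_iff)
    qed
    then have "snd z = snd y" by (rule poly_mapping_eqI)
    then have "z = y" using y(2) z(2) by (simp add: prod_eq_iff)
    obtain m' where m': "m = m' + single z 1"
      by (rule monomial_divides[of "single z 1" m])
        (use z in \<open>auto simp: lookup_single when_def in_keys_iff\<close>)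
    obtain s' where s': "s = s' + single z 1"
      by (rule monomial_divides[of "single z 1" s])
        (use y \<open>z = y\<close> in \<open>auto simp: lookup_single when_def in_keys_iff\<close>)
    have "s' = m'"
    proof (rule less.hyps)
      show "total_degree m' < total_degree m" by (simp add: m' total_degree_plus)
      show "s' \<in> monomials (zvars n a b)" "m' \<in> monomials (zvars n a b)" using sm by (auto simp: m' s')
      show "scroll_map s' = scroll_map m'" using sm(3) by (simp add: m' s' monomial_map_plus)
      show "two_valued a p s'" "two_valued a p m'" using two
        by (auto simp: m' s' two_valued_def keys_plus_nat)
    qed
    then show ?thesis by (simp add: m' s')
  qed
qed

text \<open>Suppose that the interval sums of all factors of \<open>m\<close> are within one of each other. Choose \<open>p\<close> as the
  least values; then \<open>(x - p) (x - p - 1)\<close> vanishes at every interval sum \<open>x\<close> of \<open>m\<close>, while it is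
  nonnegative at every integer. On a fibre the number of factors and the totals of the \<open>x\<close> are
  constant, so the sum of these products differs from the weight \<open>spread\<close> by a constant. Hence \<open>m\<close>
  has minimal weight, and every other monomial of minimal weight is two-valued for the same \<open>p\<close>, so
  it is \<open>m\<close>.\<close>

lemma unbalanced_pair:
  assumes sm: "s \<in> monomials (zvars n a b)" "m \<in> monomials (zvars n a b)" "scroll_map s = scroll_map m"
    and "s \<noteq> m" and le: "weight (spread a) s \<le> weight (spread a) m"
  obtains z z' l h where "z \<in> keys m" "z' \<in> keys m" "fst z = fst z'"
    "h \<le> Suc (a (fst z))" "l \<le> h" "2 \<le> block (snd z) l h - block (snd z') l h"
proof (rule ccontr)
  note found = that
  assume "\<not> thesis"
  then have close: "block (snd z) l h - block (snd z') l h \<le> 1"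
    if "z \<in> keys m" "z' \<in> keys m" "fst z = fst z'" "h \<le> Suc (a (fst z))" "l \<le> h" for z z' l h
    using found[OF that] by linarith
  define p where "p i l h = Min ((\<lambda>z. block (snd z) l h) ` {z \<in> keys m. fst z = i})" for i l h
  have two: "two_valued a p m"
    unfolding two_valued_def
  proof (intro ballI allI impI)
    fix z h l assume z: "z \<in> keys m" "h \<le> Suc (a (fst z))" "l \<le> h"
    let ?B = "(\<lambda>z. block (snd z) l h) ` {y \<in> keys m. fst y = fst z}"
    have mem: "block (snd z) l h \<in> ?B" using z(1) by blast
    then have "p (fst z) l h \<le> block (snd z) l h" unfolding p_def by (intro Min_le) simp_all
    moreover have "?B \<noteq> {}" using mem by (metis empty_iff)
    then have "p (fst z) l h \<in> ?B" unfolding p_def by (intro Min_in) simp_all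
    then obtain y where "y \<in> keys m" "fst y = fst z" "p (fst z) l h = block (snd y) l h" by auto
    with close[of z y h l] z have "block (snd z) l h \<le> p (fst z) l h + 1" by auto
    ultimately show "block (snd z) l h \<in> {p (fst z) l h, p (fst z) l h + 1}" by auto
  qed
  \<comment> \<open>The function \<open>(x - p) (x - p - 1)\<close> of the interval sum \<open>x\<close>, cut off to the first index \<open>i\<close>.\<close>
  define q where "q i l h z = of_bool (fst z = i) *
      ((block (snd z) l h - p i l h) * (block (snd z) l h - p i l h - 1))"
    for i l h and z :: "nat \<times> (nat \<Rightarrow>\<^sub>0 nat)"
  have int_prod: "0 \<le> x * (x - 1)" for x :: int
    by (cases "x \<le> 0") (auto intro: mult_nonneg_nonneg mult_nonpos_nonpos)
  have q_nonneg: "0 \<le> q i l h z" for i l h z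
    using int_prod[of "block (snd z) l h - p i l h"] by (simp add: q_def)
  have q_m: "weight (q i l h) m = 0" if "h \<le> Suc (a i)" "l \<le> h" for i l h
  proof -
    have "weight (q i l h) m = weight (\<lambda>_. 0) m"
      using two that by (intro weight_cong) (force simp: q_def two_valued_def)
    then show ?thesis by (simp add: weight_def)
  qed
  define sq where "sq i l h z = of_bool (fst z = i) * (block (snd z) l h)\<^sup>2"
    for i l h and z :: "nat \<times> (nat \<Rightarrow>\<^sub>0 nat)"
  \<comment> \<open>On a fibre only the first of these three terms varies.\<close>
  have q_sq: "weight (q i l h) x = weight (sq i l h) x
      + (- 2 * p i l h - 1) * weight (\<lambda>z. of_bool (fst z = i) * block (snd z) l h) x
      + (p i l h * (p i l h + 1)) * weight (\<lambda>z. of_bool (fst z = i)) x" for i l h x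
    unfolding weight_linear[symmetric]
    by (intro weight_cong) (simp add: q_def sq_def algebra_simps power2_eq_square)
  have sq_le: "weight (sq i l h) m \<le> weight (sq i l h) s"
    and sq_eq: "weight (sq i l h) m = weight (sq i l h) s \<Longrightarrow> weight (q i l h) s = 0"
    if "h \<le> Suc (a i)" "l \<le> h" for i l h
  proof -
    have "0 \<le> weight (q i l h) s" by (intro weight_nonneg q_nonneg)
    then show "weight (sq i l h) m \<le> weight (sq i l h) s"
      and "weight (sq i l h) m = weight (sq i l h) s \<Longrightarrow> weight (q i l h) s = 0"
      using q_m[OF that] q_sq[of i l h m] q_sq[of i l h s]
        fibre_weight_block[OF sm(3), of i l h] fibre_weight_factors[OF sm, of i] by auto
  qed
  define T where "T = (SIGMA i:{1..n}. SIGMA h:{..Suc (a i)}. {..h})"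
  have W: "weight (spread a) x = (\<Sum>(i, h, l)\<in>T. weight (sq i l h) x)" if "x \<in> monomials (zvars n a b)" for x
  proof -
    have "weight (spread a) x = weight (\<lambda>z. \<Sum>(i, h, l)\<in>T. sq i l h z) x"
    proof (rule weight_cong)
      fix z assume "z \<in> keys x"
      with that have i: "fst z \<in> {1..n}" by (auto simp: monomials_def zvars_def)
      have "(\<Sum>(i, h, l)\<in>T. sq i l h z) = (\<Sum>i\<in>{1..n}. \<Sum>h\<le>Suc (a i). \<Sum>l\<le>h. sq i l h z)"
        unfolding T_def by (simp add: sum.Sigma[symmetric] del: sum.atMost_Suc)
      also have "\<dots> = (\<Sum>i\<in>{1..n}. if i = fst z then spread a z else 0)"
        by (intro sum.cong) (auto simp: sq_def spread_def)
      also have "\<dots> = spread a z" using i by simp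
      finally show "spread a z = (\<Sum>(i, h, l)\<in>T. sq i l h z)" by simp
    qed
    then show ?thesis by (simp add: case_prod_beta' weight_fun_sum)
  qed
  have finT: "finite T" by (simp add: T_def)
  have "two_valued a p s"
    unfolding two_valued_def
  proof (intro ballI allI impI)
    fix z h l assume z: "z \<in> keys s" "h \<le> Suc (a (fst z))" "l \<le> h"
    then have t: "(fst z, h, l) \<in> T" using sm(1) by (auto simp: T_def monomials_def zvars_def)
    have "weight (sq (fst z) l h) m = weight (sq (fst z) l h) s"
    proof (rule ccontr)
      assume "weight (sq (fst z) l h) m \<noteq> weight (sq (fst z) l h) s"
      with sq_le[OF z(2,3)] have less: "weight (sq (fst z) l h) m < weight (sq (fst z) l h) s" by simp
      have "weight (spread a) m < weight (spread a) s"
        unfolding W[OF sm(1)] W[OF sm(2)]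
      proof (rule sum_strict_mono_ex1[OF finT])
        show "\<forall>x\<in>T. (case x of (i, h, l) \<Rightarrow> weight (sq i l h) m)
            \<le> (case x of (i, h, l) \<Rightarrow> weight (sq i l h) s)"
          using sq_le by (auto simp: T_def)
        show "\<exists>x\<in>T. (case x of (i, h, l) \<Rightarrow> weight (sq i l h) m)
            < (case x of (i, h, l) \<Rightarrow> weight (sq i l h) s)"
          using less by (intro bexI[OF _ t]) simp
      qed
      with le show False by simp
    qed
    then have "q (fst z) l h z = 0"
      using weight_eq_0D[OF sq_eq[OF z(2,3)] _ z(1)] q_nonneg by blast
    then show "block (snd z) l h \<in> {p (fst z) l h, p (fst z) l h + 1}" by (auto simp: q_def)
  qed
  with two_valued_unique[OF sm this two] \<open>s \<noteq> m\<close> show False by simp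
qed

text \<open>The variables \<open>z\<close>, \<open>z'\<close> are distinct because they have different interval sums; this is why the
  leading monomials of the quadratic binomials are squarefree.\<close>

lemma quadratic_divisor:
  assumes sm: "s \<in> monomials (zvars n a b)" "m \<in> monomials (zvars n a b)" "scroll_map s = scroll_map m"
    and "s \<noteq> m" and le: "weight (spread a) s \<le> weight (spread a) m"
  obtains z z' u q' where "z \<noteq> z'" "m = u + (single z 1 + single z' 1)"
    "q' \<in> monomials (zvars n a b)" "total_degree q' = 2"
    "scroll_map q' = scroll_map (single z 1 + single z' 1)"
    "weight (spread a) q' < weight (spread a) (single z 1 + single z' 1)"
proof -
  obtain z z' l h where z: "z \<in> keys m" "z' \<in> keys m" "fst z = fst z'"
    and gap: "h \<le> Suc (a (fst z))" "l \<le> h" "2 \<le> block (snd z) l h - block (snd z') l h"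
    by (rule unbalanced_pair[OF assms])
  have "z \<noteq> z'" using gap(3) by auto
  obtain u where u: "m = u + (single z 1 + single z' 1)"
    by (rule monomial_divides[of "single z 1 + single z' 1" m])
      (use z \<open>z \<noteq> z'\<close> in \<open>auto simp: lookup_add lookup_single when_def in_keys_iff\<close>)
  have "z \<in> zvars n a b" "z' \<in> zvars n a b" using z sm(2) by (auto simp: monomials_def)
  then have zi: "(fst z, snd z) \<in> zvars n a b" "(fst z, snd z') \<in> zvars n a b" by (simp, simp add: z(3))
  obtain \<alpha>' \<beta>' where new: "(fst z, \<alpha>') \<in> zvars n a b" "(fst z, \<beta>') \<in> zvars n a b"
    and sum: "\<And>j. lookup \<alpha>' j + lookup \<beta>' j = lookup (snd z) j + lookup (snd z') j"
    and less: "spread a (fst z, \<alpha>') + spread a (fst z, \<beta>')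
      < spread a (fst z, snd z) + spread a (fst z, snd z')"
    by (rule rebalance[OF zi gap(2,1)]) (use gap(3) in auto)
  let ?q' = "single (fst z, \<alpha>') 1 + single (fst z, \<beta>') 1"
  show ?thesis
  proof (rule that[OF \<open>z \<noteq> z'\<close> u, of ?q'])
    show "?q' \<in> monomials (zvars n a b)" using new by simp
    show "total_degree ?q' = 2" by (simp add: total_degree_plus)
    show "scroll_map ?q' = scroll_map (single z 1 + single z' 1)"
      using sum z(3) unfolding monomial_map_plus monomial_map_single
      by (intro poly_mapping_eqI) (simp add: lookup_add lookup_scroll_exponent)
    show "weight (spread a) ?q' < weight (spread a) (single z 1 + single z' 1)"
      using less arg_cong[OF z(3), of "\<lambda>i. spread a (i, snd z')"] by (simp add: weight_plus)
  qed
qed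

end


section \<open>The term order\<close>

text \<open>The image monomial comes first, so that a leading monomial whose image does not cancel lies over a
  leading monomial of \<open>I\<close>; within a fibre the weight decides, so that the evenly distributed monomial is least. The
  lexicographic order \<open>s \<le> t\<close> only makes the order total.\<close>

definition scroll_order ::
    "nat \<Rightarrow> (nat \<Rightarrow> nat) \<Rightarrow> (nat \<Rightarrow> nat) \<Rightarrow> (nat \<times> nat) monomial rel
      \<Rightarrow> (nat \<times> (nat \<Rightarrow>\<^sub>0 nat)) monomial rel" where
  "scroll_order n a b r = {(s, t). s \<in> monomials (zvars n a b) \<and> t \<in> monomials (zvars n a b) \<and>
     (if scroll_map s = scroll_map t
      then weight (spread a) s < weight (spread a) t \<or>
        weight (spread a) s = weight (spread a) t \<and> s \<le> t
      else (scroll_map s, scroll_map t) \<in> r)}"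

lemma zero_le_monomial: "0 \<le> (t :: 'v::linorder monomial)"
proof (rule ccontr)
  assume "\<not> 0 \<le> t"
  then have "t < 0" by simp
  then show False by (auto simp: less_poly_mapping.rep_eq less_fun_def)
qed

text \<open>As \<open>r\<close> is reflexive, the case distinction can be replaced by a conjunction, which suits transitivity
  and antisymmetry.\<close>

lemma scroll_order_iff:
  assumes "term_order (xvars n a) r"
  shows "(s, t) \<in> scroll_order n a b r \<longleftrightarrow>
    s \<in> monomials (zvars n a b) \<and> t \<in> monomials (zvars n a b) \<and> (scroll_map s, scroll_map t) \<in> r \<and>
    (scroll_map s = scroll_map t \<longrightarrow> weight (spread a) s < weight (spread a) t \<or>
      weight (spread a) s = weight (spread a) t \<and> s \<le> t)"
  unfolding scroll_order_def using term_orderD(1)[OF assms scroll_map_in_monomials[of t n a b]]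
  by simp metis

lemma term_order_scroll_order:
  assumes r: "term_order (xvars n a) r"
  shows "term_order (zvars n a b) (scroll_order n a b r)"
proof -
  let ?r' = "scroll_order n a b r" and ?W = "weight (spread a)"
  note iff = scroll_order_iff[OF r, of _ _ b]
  note r_monomials = scroll_map_in_monomials[of _ n a b]
  have refl: "(s, s) \<in> ?r'" if "s \<in> monomials (zvars n a b)" for s
    using that term_orderD(1)[OF r r_monomials[OF that]] by (simp add: iff)
  have trans: "(s, u) \<in> ?r'" if st: "(s, t) \<in> ?r'" and tu: "(t, u) \<in> ?r'" for s t u
  proof -
    have "?W s < ?W u \<or> ?W s = ?W u \<and> s \<le> u" if "scroll_map s = scroll_map u"
    proof -
      have "scroll_map s = scroll_map t"
        using st tu that by (intro term_orderD(3)[OF r]) (auto simp: iff)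
      with st tu that show ?thesis by (auto simp: iff)
    qed
    with st tu show ?thesis using term_orderD(2)[OF r] unfolding iff by blast
  qed
  have antisym: "s = t" if st: "(s, t) \<in> ?r'" and ts: "(t, s) \<in> ?r'" for s t
  proof -
    have "scroll_map s = scroll_map t"
      using st ts by (intro term_orderD(3)[OF r]) (auto simp: iff)
    with st ts show ?thesis by (auto simp: iff)
  qed
  have total: "(s, t) \<in> ?r' \<or> (t, s) \<in> ?r'"
    if "s \<in> monomials (zvars n a b)" "t \<in> monomials (zvars n a b)" for s t
    using that term_orderD(4)[OF r r_monomials[OF that(1)] r_monomials[OF that(2)]]
    unfolding iff by (metis linorder_less_linear linorder_linear)
  have zero: "(0, t) \<in> ?r'" if "t \<in> monomials (zvars n a b)" for t
  proof -
    have "0 \<le> ?W t"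
      unfolding spread_def by (intro weight_nonneg sum_nonneg) simp
    with that zero_le_monomial[of t] term_orderD(6)[OF r r_monomials[OF that]] show ?thesis
      by (auto simp: iff)
  qed
  have plus: "(s + u, t + u) \<in> ?r'"
    if st: "(s, t) \<in> ?r'" and u: "u \<in> monomials (zvars n a b)" for s t u
  proof -
    have "(scroll_map u + scroll_map s, scroll_map u + scroll_map t) \<in> r"
      using st by (intro term_orderD(5)[OF r] r_monomials u) (auto simp: iff)
    with st u show ?thesis
      by (auto simp: iff monomial_map_plus weight_plus add.commute[of "scroll_map u"] intro: add_right_mono)
  qed
  have "?r' \<subseteq> monomials (zvars n a b) \<times> monomials (zvars n a b)" by (auto simp: iff)
  moreover have "refl_on (monomials (zvars n a b)) ?r'" using refl by (auto simp: refl_on_def iff)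
  moreover have "trans ?r'" using trans by (rule transI)
  moreover have "antisym ?r'" using antisym by (rule antisymI)
  moreover have "total_on (monomials (zvars n a b)) ?r'" using total by (auto simp: total_on_def)
  ultimately show ?thesis
    unfolding term_order_def linear_order_on_def partial_order_on_def preorder_on_def
    using zero plus by blast
qed


section \<open>Membership in the ideal of the scroll\<close>

lemma prod_single:
  "(\<Prod>x\<in>A. single (f x) (1 :: 'k::field)) = single (\<Sum>x\<in>A. f x) 1"
  by (induction A rule: infinite_finite_induct) (simp_all add: mult_single)

lemma power_single: "single e (1 :: 'k::field) ^ k = single (\<Sum>_<k. e) 1"
  using prod_single[of "\<lambda>_. e" "{..<k}"] by simp

lemma scroll_monomial_eq:
  assumes "z \<in> zvars n a b"
  shows "scroll_monomial a z = single (scroll_exponent z) (1 :: 'k::field)"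
proof -
  obtain i \<alpha> where z: "z = (i, \<alpha>)" by (cases z)
  have rep: "(\<Sum>_<k. single x (1::nat)) = single x k" for x :: "nat \<times> nat" and k
    by (rule poly_mapping_eqI) (simp add: lookup_sum lookup_single when_def)
  have "scroll_monomial a z = single (\<Sum>j\<in>{0..a i}. single (i, j) (lookup \<alpha> j)) (1 :: 'k)"
    by (simp add: z scroll_monomial_def mvar_def power_single prod_single rep[unfolded One_nat_def])
  also have "(\<Sum>j\<in>{0..a i}. single (i, j) (lookup \<alpha> j)) = scroll_exponent z"
    unfolding scroll_exponent_def using assms z
    by (intro sum.mono_neutral_cong_right) (auto simp: zvars_def in_keys_iff)
  finally show ?thesis .
qed

lemma mpoly_subst_scroll:
  fixes p :: "(nat \<times> (nat \<Rightarrow>\<^sub>0 nat), 'k::field) mpoly"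
  assumes "keys p \<subseteq> monomials (zvars n a b)"
  shows "mpoly_subst (scroll_monomial a) p = (\<Sum>m\<in>keys p. single (scroll_map m) (lookup p m))"
proof -
  have "(\<Prod>v\<in>keys m. scroll_monomial a v ^ lookup m v) = single (scroll_map m) (1 :: 'k)"
    if "m \<in> keys p" for m
  proof -
    have "v \<in> zvars n a b" if "v \<in> keys m" for v
      using that \<open>m \<in> keys p\<close> assms by (auto simp: monomials_def)
    then have "(\<Prod>v\<in>keys m. scroll_monomial a v ^ lookup m v)
        = (\<Prod>v\<in>keys m. single (\<Sum>_<lookup m v. scroll_exponent v) (1 :: 'k))"
      by (intro prod.cong refl) (simp add: scroll_monomial_eq[of _ n a b] power_single)
    then show ?thesis by (simp add: prod_single monomial_map_def)
  qed
  then show ?thesis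
    unfolding mpoly_subst_def by (intro sum.cong) (auto simp: mconst_def mult_single)
qed

lemma lookup_mpoly_subst_scroll:
  fixes p :: "(nat \<times> (nat \<Rightarrow>\<^sub>0 nat), 'k::field) mpoly"
  assumes "keys p \<subseteq> monomials (zvars n a b)"
  shows "lookup (mpoly_subst (scroll_monomial a) p) u
    = (\<Sum>m\<in>{m\<in>keys p. scroll_map m = u}. lookup p m)"
  unfolding mpoly_subst_scroll[OF assms] lookup_sum
  by (simp add: lookup_single when_def sum.inter_filter)

lemma keys_mpoly_subst_scroll:
  fixes p :: "(nat \<times> (nat \<Rightarrow>\<^sub>0 nat), 'k::field) mpoly"
  assumes "keys p \<subseteq> monomials (zvars n a b)"
  shows "keys (mpoly_subst (scroll_monomial a) p) \<subseteq> scroll_map ` keys p"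
proof
  fix u assume "u \<in> keys (mpoly_subst (scroll_monomial a) p)"
  then have "{m \<in> keys p. scroll_map m = u} \<noteq> {}"
    unfolding in_keys_iff lookup_mpoly_subst_scroll[OF assms] by (metis sum.empty)
  then show "u \<in> scroll_map ` keys p" by blast
qed

lemma scroll_ideal_iff:
  fixes I :: "(nat \<times> nat, 'k::field) mpoly set"
  assumes I: "ideal I (mpoly_ring (xvars n a))"
  shows "p \<in> scroll_ideal n a b I \<longleftrightarrow>
    keys p \<subseteq> monomials (zvars n a b) \<and> mpoly_subst (scroll_monomial a) p \<in> I"
proof -
  let ?R = "mpoly_ring (xvars n a) :: (nat \<times> nat, 'k) mpoly ring"
  interpret ideal I ?R by fact
  have "I +>\<^bsub>?R\<^esub> f = I \<longleftrightarrow> f \<in> I" if "f \<in> carrier ?R" for f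
    using that a_coset_join1 a_coset_join2 a_subgroup by blast
  moreover have "mpoly_subst (scroll_monomial a) p \<in> carrier ?R"
    if "keys p \<subseteq> monomials (zvars n a b)"
    using keys_mpoly_subst_scroll[OF that] scroll_map_in_monomials[of _ n a b] that by auto
  ultimately show ?thesis
    unfolding scroll_ideal_def a_kernel_def kernel_def by (auto simp: FactRing_def)
qed


section \<open>Lifting forms of the ideal\<close>

lemma multidegree_weight: "multidegree m i = weight (\<lambda>v. of_bool (fst v = i)) m"
  unfolding multidegree_def weight_def by (simp add: sum.inter_filter of_bool_def if_distrib cong: if_cong)

lemma multidegree_plus: "multidegree (s + t) i = multidegree s i + multidegree t i"
  by (simp add: multidegree_weight weight_plus)

lemma lookup_multigraded_component:
  "lookup (multigraded_component d p) m = (if multidegree m = d then lookup p m else 0)"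
  unfolding multigraded_component_def lookup_sum
  by (auto simp: lookup_single when_def in_keys_iff)

lemma multidegree_slice:
  "multidegree u i = int (total_degree (Poly_Mapping.map_key (Pair i) u))"
proof -
  have inj: "inj (Pair i)" by (simp add: inj_def)
  have "bij_betw (Pair i) (keys (Poly_Mapping.map_key (Pair i) u)) {v \<in> keys u. fst v = i}"
    using inj by (auto simp: bij_betw_def inj_on_def keys_map_key image_iff)
  then show ?thesis
    unfolding multidegree_def total_degree_def
    by (simp flip: sum.reindex_bij_betw add: map_key.rep_eq[OF inj])
qed

lemma multidegree_scroll_exponent:
  assumes "z \<in> zvars n a b"
  shows "multidegree (scroll_exponent z) i = (if i = fst z then int (b i) else 0)"
proof -
  have inj: "inj (Pair i)" by (simp add: inj_def)
  have "Poly_Mapping.map_key (Pair i) (scroll_exponent z) = (if i = fst z then snd z else 0)"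
    by (rule poly_mapping_eqI) (simp add: map_key.rep_eq[OF inj] lookup_scroll_exponent)
  moreover have "total_degree (snd z) = b (fst z)"
    using assms weight_superset[of "{0..a (fst z)}" "snd z" "\<lambda>_. 1 :: nat"]
    by (auto simp: total_degree_weight zvars_def)
  ultimately show ?thesis by (simp add: multidegree_slice)
qed

text \<open>The monomials of \<open>A\<close> in the image are exactly those whose degree in the \<open>i\<close>-th variables is a multiple
  of \<open>b\<^sub>i\<close> for every \<open>i\<close>: peel off a divisor of degree \<open>b\<^sub>i\<close> for each factor of \<open>m\<close>. The total degree of
  the preimage is that of \<open>m\<close>, which is what makes the lifts below homogeneous.\<close>

lemma monomial_lift:
  assumes "m \<in> monomials (zvars n a b)" "u \<in> monomials (xvars n a)"
    and "multidegree u = multidegree (scroll_map m)"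
  shows "\<exists>s\<in>monomials (zvars n a b). scroll_map s = u \<and> total_degree s = total_degree m"
  using assms
proof (induction m arbitrary: u rule: monomial_induct)
  case zero
  have "lookup u x = 0" for x
  proof (rule ccontr)
    assume "lookup u x \<noteq> 0"
    then have x: "x \<in> keys u" by (simp add: in_keys_iff)
    have "multidegree u (fst x) = 0" 
      using fun_cong[OF zero.prems(3), of "fst x"] by (simp add: multidegree_weight)
    then show False using weight_eq_0D[OF _ _ x, of "\<lambda>v. of_bool (fst v = fst x) :: int"]
      by (simp add: multidegree_weight)
  qed
  then have "u = 0" by (intro poly_mapping_eqI) simp
  then show ?case by (intro bexI[of _ 0]) auto
next
  case (plus m v)
  define i where "i = fst v"
  have v: "v \<in> zvars n a b" and m: "m \<in> monomials (zvars n a b)" using plus.prems(1) by auto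
  have i: "i \<in> {1..n}" using v by (auto simp: i_def zvars_def)
  have inj: "inj (Pair i)" by (simp add: inj_def)
  define w where "w = Poly_Mapping.map_key (Pair i) u"
  have lw: "lookup w j = lookup u (i, j)" for j by (simp add: w_def map_key.rep_eq[OF inj])
  have md: "multidegree u j = multidegree (scroll_map m) j + (if j = i then int (b i) else 0)" for j
    using plus.prems(3) multidegree_scroll_exponent[OF v, of j]
    by (simp add: monomial_map_plus multidegree_plus i_def del: One_nat_def)
  have "0 \<le> multidegree (scroll_map m) i" by (simp add: multidegree_def sum_nonneg)
  with md[of i] have "b i \<le> total_degree w" by (simp add: multidegree_slice w_def)
  then obtain \<beta> \<gamma> where \<beta>: "w = \<gamma> + \<beta>" "total_degree \<beta> = b i" by (rule divisor_of_total_degree)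
  have "keys w \<subseteq> {0..a i}"
  proof
    fix j assume "j \<in> keys w"
    then have "(i, j) \<in> keys u" by (simp add: in_keys_iff lw)
    then have "(i, j) \<in> xvars n a" using plus.prems(2) by (auto simp: monomials_def)
    then show "j \<in> {0..a i}" by (simp add: xvars_def)
  qed
  then have keys\<beta>: "keys \<beta> \<subseteq> {0..a i}" by (auto simp: \<beta>(1) keys_plus_nat)
  then have z: "(i, \<beta>) \<in> zvars n a b"
    using i \<beta>(2) weight_superset[of "{0..a i}" \<beta> "\<lambda>_. 1 :: nat"]
    by (simp add: zvars_def total_degree_weight)
  have le: "lookup \<beta> j \<le> lookup u (i, j)" for j
    using lw[of j] by (simp add: \<beta>(1) lookup_add)
  obtain u0 where u0: "u = u0 + scroll_exponent (i, \<beta>)"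
    by (rule monomial_divides[of "scroll_exponent (i, \<beta>)" u])
      (use le in \<open>auto simp: lookup_scroll_exponent\<close>)
  have "multidegree u0 = multidegree (scroll_map m)"
  proof
    fix j show "multidegree u0 j = multidegree (scroll_map m) j"
      using md[of j] multidegree_scroll_exponent[OF z, of j]
      by (simp add: u0 multidegree_plus split: if_splits)
  qed
  moreover have "u0 \<in> monomials (xvars n a)" using plus.prems(2) u0 by simp
  ultimately obtain s where s: "s \<in> monomials (zvars n a b)" "scroll_map s = u0"
      "total_degree s = total_degree m"
    using plus.IH[OF m] by blast
  show ?case
  proof (intro bexI conjI)
    show "scroll_map (s + single (i, \<beta>) 1) = u"
      unfolding monomial_map_plus monomial_map_single s(2) u0 ..
    show "total_degree (s + single (i, \<beta>) 1) = total_degree (m + single v 1)"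
      using s(3) by (simp add: total_degree_plus)
    show "s + single (i, \<beta>) 1 \<in> monomials (zvars n a b)" using s(1) z by simp
  qed
qed

text \<open>Because \<open>I\<close> is multigraded, \<open>f\<close> may be replaced by its component in the multidegree of its leading
  monomial. All monomials of this component have a preimage of the same total degree; lift them one
  by one, the leading monomial to \<open>m\<close>.\<close>

lemma form_lift:
  fixes I :: "(nat \<times> nat, 'k::field) mpoly set"
  assumes I: "ideal I (mpoly_ring (xvars n a))" and "multigraded I"
    and r: "term_order (xvars n a) r"
    and f: "f \<in> I" "f \<noteq> 0" "leading_monomial r f = scroll_map m"
    and m: "m \<in> monomials (zvars n a b)"
  obtains F where "F \<in> scroll_ideal n a b I" "F \<noteq> 0" "form_of_degree (total_degree m) F"
    "leading_monomial (scroll_order n a b r) F = m"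
proof -
  define f1 where "f1 = multigraded_component (multidegree (scroll_map m)) f"
  have f1I: "f1 \<in> I" using assms(2) f(1) by (simp add: f1_def multigraded_def)
  have f1: "keys f1 = {u \<in> keys f. multidegree u = multidegree (scroll_map m)}"
    by (auto simp: f1_def in_keys_iff lookup_multigraded_component split: if_splits)
  have fV: "keys f \<subseteq> monomials (xvars n a)"
    using f(1) ideal.Icarr[OF I] by auto
  have lead: "scroll_map m \<in> keys f1" "\<And>u. u \<in> keys f1 \<Longrightarrow> (u, scroll_map m) \<in> r"
    using leading_monomial[OF r f(2) fV] f(3) by (auto simp: f1)
  have "\<forall>u\<in>keys f1. \<exists>s. s \<in> monomials (zvars n a b) \<and> scroll_map s = u \<and> total_degree s = total_degree m"
    using monomial_lift[OF m] fV by (fastforce simp: f1)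
  then obtain \<sigma>0 where \<sigma>0: "\<forall>u\<in>keys f1. \<sigma>0 u \<in> monomials (zvars n a b) \<and>
      scroll_map (\<sigma>0 u) = u \<and> total_degree (\<sigma>0 u) = total_degree m"
    by metis
  \<comment> \<open>Any section of \<open>scroll_map\<close> would do, except that the leading monomial has to be lifted to \<open>m\<close>.\<close>
  define \<sigma> where "\<sigma> = \<sigma>0(scroll_map m := m)"
  have \<sigma>: "\<sigma> u \<in> monomials (zvars n a b)" "scroll_map (\<sigma> u) = u" "total_degree (\<sigma> u) = total_degree m"
    if "u \<in> keys f1" for u using \<sigma>0 that m by (auto simp: \<sigma>_def)
  have inj: "inj_on \<sigma> (keys f1)" using \<sigma>(2) by (metis inj_onI)
  define F where "F = (\<Sum>u\<in>keys f1. single (\<sigma> u) (lookup f1 u))"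
  have F\<sigma>: "lookup F (\<sigma> u) = lookup f1 u" if "u \<in> keys f1" for u
  proof -
    have "lookup F (\<sigma> u) = (\<Sum>v\<in>keys f1. if v = u then lookup f1 v else 0)"
      unfolding F_def lookup_sum using inj that
      by (intro sum.cong) (auto simp: lookup_single when_def inj_on_def)
    with that show ?thesis by simp
  qed
  have keysF: "keys F = \<sigma> ` keys f1"
  proof
    show "keys F \<subseteq> \<sigma> ` keys f1"
    proof (rule subsetI, rule ccontr)
      fix s assume "s \<in> keys F" "s \<notin> \<sigma> ` keys f1"
      moreover from this have "lookup F s = 0"
        unfolding F_def lookup_sum by (intro sum.neutral) (auto simp: lookup_single when_def)
      ultimately show False by (simp add: in_keys_iff)
    qed
    show "\<sigma> ` keys f1 \<subseteq> keys F" using F\<sigma> by (auto simp: in_keys_iff)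
  qed
  have FV: "keys F \<subseteq> monomials (zvars n a b)" using \<sigma>(1) by (auto simp: keysF)
  have "mpoly_subst (scroll_monomial a) F = (\<Sum>u\<in>keys f1. single u (lookup f1 u))"
    unfolding mpoly_subst_scroll[OF FV] keysF sum.reindex[OF inj] using \<sigma>(2) F\<sigma> by simp
  also have "\<dots> = f1"
    by (rule poly_mapping_eqI) (simp add: lookup_sum lookup_single when_def in_keys_iff)
  finally have "F \<in> scroll_ideal n a b I" using f1I FV by (simp add: scroll_ideal_iff[OF I])
  moreover have mF: "m \<in> keys F" using lead(1) by (force simp: keysF \<sigma>_def)
  moreover have "form_of_degree (total_degree m) F" using \<sigma>(3) by (auto simp: form_of_degree_def keysF)
  moreover have "leading_monomial (scroll_order n a b r) F = m"
  proof (rule leading_monomial_eqI[OF term_order_scroll_order[OF r] mF])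
    fix s assume "s \<in> keys F"
    then obtain u where u: "u \<in> keys f1" "s = \<sigma> u" by (auto simp: keysF)
    show "(s, m) \<in> scroll_order n a b r"
    proof (cases "u = scroll_map m")
      case True
      then have "s = m" using u by (simp add: \<sigma>_def)
      then show ?thesis using term_orderD(1)[OF term_order_scroll_order[OF r] m] by simp
    next
      case False
      then show ?thesis using \<sigma>[OF u(1)] lead(2)[OF u(1)] u(2) m by (simp add: scroll_order_def)
    qed
  qed
  moreover have "F \<noteq> 0" using mF by auto
  ultimately show ?thesis using that by blast
qed

text \<open>Two monomials in the same fibre have the same image, so their difference is mapped to zero.\<close>

lemma binomial_in_scroll_ideal:
  fixes I :: "(nat \<times> nat, 'k::field) mpoly set"
  assumes I: "ideal I (mpoly_ring (xvars n a))" and r: "term_order (xvars n a) r"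
    and q: "q \<in> monomials (zvars n a b)" "q' \<in> monomials (zvars n a b)"
      "scroll_map q' = scroll_map q" "weight (spread a) q' < weight (spread a) q"
      "total_degree q' = total_degree q"
  obtains F where "F \<in> scroll_ideal n a b I" "F \<noteq> 0" "form_of_degree (total_degree q) F"
    "leading_monomial (scroll_order n a b r) F = q"
proof -
  define F :: "(nat \<times> (nat \<Rightarrow>\<^sub>0 nat), 'k) mpoly" where "F = single q 1 - single q' 1"
  have ne: "q \<noteq> q'" using q(4) by auto
  have look: "lookup F q = 1" "lookup F q' = - 1"
    using ne by (auto simp: F_def lookup_minus lookup_single when_def)
  have keysF: "keys F = {q, q'}"
    using ne by (auto simp: F_def in_keys_iff lookup_minus lookup_single when_def split: if_splits)
  have FV: "keys F \<subseteq> monomials (zvars n a b)" using q keysF by auto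
  have "mpoly_subst (scroll_monomial a) F = 0"
    unfolding mpoly_subst_scroll[OF FV] keysF using ne look q(3) by (simp add: single_uminus)
  moreover have "0 \<in> I"
    using additive_subgroup.zero_closed[OF ideal.axioms(1)[OF I]] by simp
  ultimately have "F \<in> scroll_ideal n a b I" using FV by (simp add: scroll_ideal_iff[OF I])
  moreover have "F \<noteq> 0" using look by auto
  moreover have "form_of_degree (total_degree q) F" using q(5) by (auto simp: form_of_degree_def keysF)
  moreover have "leading_monomial (scroll_order n a b r) F = q"
    by (rule leading_monomial_eqI[OF term_order_scroll_order[OF r]])
      (use q in \<open>auto simp: keysF scroll_order_def\<close>)
  ultimately show ?thesis using that by blast
qed


section \<open>The Groebner basis of the scroll\<close>

text \<open>To cover \<open>g\<close> by the image of a divisor of \<open>m\<close>, one factor of \<open>m\<close> suffices for each variable of \<open>g\<close>,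
  counted with multiplicity. If \<open>g\<close> is squarefree, a new factor is added only for a variable that does
  not yet occur in the image, so it is different from all the factors chosen before.\<close>

lemma covering_divisor:
  fixes m :: "'v monomial" and g :: "'w monomial"
  assumes "\<And>x. lookup g x \<le> lookup (monomial_map e m) x"
  shows "\<exists>u m'. m = u + m' \<and> total_degree m' \<le> total_degree g \<and>
    (\<forall>x. lookup g x \<le> lookup (monomial_map e m') x) \<and>
    ((\<forall>x. lookup g x \<le> 1) \<longrightarrow> (\<forall>v. lookup m' v \<le> 1))"
  using assms
proof (induction g rule: monomial_induct)
  case zero
  show ?case by (rule exI[of _ m], rule exI[of _ 0]) simp
next
  case (plus g x)
  have "lookup g y \<le> lookup (monomial_map e m) y" for y
    using plus.prems[of y] by (simp add: lookup_add)
  from plus.IH[OF this] obtain u m' where m: "m = u + m'" "total_degree m' \<le> total_degree g"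
    and cov: "\<And>y. lookup g y \<le> lookup (monomial_map e m') y"
    and sqf: "(\<forall>x. lookup g x \<le> 1) \<longrightarrow> (\<forall>v. lookup m' v \<le> 1)" by blast
  have sqf_g: "\<forall>y. lookup g y \<le> 1" if "\<forall>y. lookup (g + single x 1) y \<le> 1"
  proof
    fix y show "lookup g y \<le> 1" using that[rule_format, of y] by (simp add: lookup_add)
  qed
  show ?case
  proof (cases "lookup g x < lookup (monomial_map e m') x")
    case True
    have "lookup (g + single x 1) y \<le> lookup (monomial_map e m') y" for y
      using True cov[of y] by (auto simp: lookup_add lookup_single when_def)
    moreover have "total_degree m' \<le> total_degree (g + single x 1)"
      using m(2) by (simp add: total_degree_plus)
    ultimately show ?thesis using m(1) sqf sqf_g by blast
  next
    case False
    then have eq: "lookup (monomial_map e m') x = lookup g x" using cov[of x] by simp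
    have "lookup (monomial_map e m) x > lookup g x"
      using plus.prems[of x] by (simp add: lookup_add)
    then have "weight (\<lambda>v. lookup (e v) x) u \<noteq> 0"
      using eq by (simp add: m(1) monomial_map_plus lookup_add lookup_monomial_map)
    then obtain z where z: "z \<in> keys u" "lookup (e z) x \<noteq> 0"
      unfolding weight_def by (metis (mono_tags, lifting) mult_zero_right sum.neutral)
    obtain u' where u': "u = u' + single z 1"
      by (rule monomial_divides[of "single z 1" u])
        (use z in \<open>auto simp: lookup_single when_def in_keys_iff\<close>)
    let ?m = "m' + single z 1"
    have "m = u' + ?m" by (simp add: m(1) u' ac_simps)
    moreover have "total_degree ?m \<le> total_degree (g + single x 1)"
      using m(2) by (simp add: total_degree_plus)
    moreover have "lookup (g + single x 1) y \<le> lookup (monomial_map e ?m) y" for y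
      using cov[of y] z(2) unfolding monomial_map_plus monomial_map_single
      by (auto simp: lookup_add lookup_single when_def)
    moreover have "\<forall>v. lookup ?m v \<le> 1" if sq: "\<forall>y. lookup (g + single x 1) y \<le> 1"
    proof
      fix v
      have "lookup g x = 0" using sq[rule_format, of x] by (simp add: lookup_add)
      then have "weight (\<lambda>v. lookup (e v) x) m' = 0" using eq by (simp add: lookup_monomial_map)
      then have "z \<notin> keys m'" using weight_eq_0D[of _ m' z] z(2) by force
      then have "lookup m' z = 0" by (simp add: in_keys_iff)
      moreover have "lookup m' v \<le> 1" using sqf sqf_g[OF sq] by blast
      ultimately show "lookup ?m v \<le> 1" by (auto simp: lookup_add lookup_single when_def)
    qed
    ultimately show ?thesis by blast
  qed
qed

text \<open>Either the coefficient of \<open>scroll_map m\<close> in the image of \<open>h\<close> survives, and then this monomial is leading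
  because the order compares images first; or it cancels, and then \<open>h\<close> contains another monomial
  of the same fibre, which is smaller than the leading monomial \<open>m\<close>.\<close>

lemma leading_monomial_scroll:
  fixes I :: "(nat \<times> nat, 'k::field) mpoly set"
  assumes I: "ideal I (mpoly_ring (xvars n a))" and r: "term_order (xvars n a) r"
    and h: "h \<in> scroll_ideal n a b I" "h \<noteq> 0" "leading_monomial (scroll_order n a b r) h = m"
  shows "(\<exists>f\<in>I. f \<noteq> 0 \<and> leading_monomial r f = scroll_map m) \<or>
    (\<exists>s\<in>monomials (zvars n a b). s \<noteq> m \<and> scroll_map s = scroll_map m \<and>
      weight (spread a) s \<le> weight (spread a) m)"
proof -
  let ?f = "mpoly_subst (scroll_monomial a) h"
  have hV: "keys h \<subseteq> monomials (zvars n a b)" and fI: "?f \<in> I"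
    using h(1) by (simp_all add: scroll_ideal_iff[OF I])
  note lead = leading_monomial[OF term_order_scroll_order[OF r] h(2) hV, unfolded h(3)]
  show ?thesis
  proof (cases "scroll_map m \<in> keys ?f")
    case True
    have "leading_monomial r ?f = scroll_map m"
    proof (rule leading_monomial_eqI[OF r True])
      fix u assume "u \<in> keys ?f"
      then obtain s where s: "s \<in> keys h" "u = scroll_map s"
        using keys_mpoly_subst_scroll[OF hV] by blast
      have "(s, m) \<in> scroll_order n a b r" by (rule lead(2)[OF s(1)])
      moreover have "scroll_map m \<in> monomials (xvars n a)"
        using lead(1) hV by (intro scroll_map_in_monomials[of _ n a b]) auto
      ultimately show "(u, scroll_map m) \<in> r"
        using term_orderD(1)[OF r] by (auto simp: s(2) scroll_order_def split: if_splits)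
    qed
    moreover have "?f \<noteq> 0" using True by auto
    ultimately show ?thesis using fI by blast
  next
    case False
    let ?A = "{s \<in> keys h. scroll_map s = scroll_map m}"
    have "(\<Sum>s\<in>?A. lookup h s) = 0"
      using False unfolding in_keys_iff lookup_mpoly_subst_scroll[OF hV] by simp
    moreover have "lookup h m \<noteq> 0" using lead(1) by (simp add: in_keys_iff)
    ultimately have "?A \<noteq> {m}" by auto
    with lead(1) obtain s where s: "s \<in> ?A" "s \<noteq> m" by blast
    then have "(s, m) \<in> scroll_order n a b r" using lead(2) by auto
    with s have "weight (spread a) s \<le> weight (spread a) m" by (auto simp: scroll_order_def)
    with s hV show ?thesis by blast
  qed
qed

lemma finite_zvars: "finite (zvars n a b)"
proof -
  have "{\<alpha>. keys \<alpha> \<subseteq> {0..A} \<and> (\<Sum>j\<in>{0..A}. lookup \<alpha> j) = B}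
      \<subseteq> {m \<in> monomials {0..A}. total_degree m \<le> B}" for A B :: nat
    using weight_superset[of "{0..A}" _ "\<lambda>_. 1 :: nat"]
    by (auto simp: monomials_def total_degree_weight)
  then have "finite {\<alpha>. keys \<alpha> \<subseteq> {0..A} \<and> (\<Sum>j\<in>{0..A}. lookup \<alpha> j) = B}" for A B :: nat
    using finite_monomials_total_degree_le by (rule finite_subset) simp
  then show ?thesis unfolding zvars_def by (intro finite_SigmaI) simp_all
qed

text \<open>This joins the two sources of leading monomials: lifts of forms of \<open>I\<close>, with degree bounded
  by that of an element of \<open>G\<close>, and quadratic binomials, for which \<open>\<delta> \<ge> 2\<close> is needed.
  The leading monomial itself is also bounded in degree, since this makes the set of leading
  monomials finite.\<close>

lemma scroll_leading_monomial_divisor: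
  fixes I :: "(nat \<times> nat, 'k::field) mpoly set"
  assumes I: "ideal I (mpoly_ring (xvars n a))" and multi: "multigraded I"
    and \<delta>: "2 \<le> \<delta>" and r: "term_order (xvars n a) r"
    and G: "groebner_basis (xvars n a) r I G" "forms_of_degree_le \<delta> G"
    and b: "\<forall>i\<in>{1..n}. 0 < b i"
    and h: "h \<in> scroll_ideal n a b I" "h \<noteq> 0"
  defines "r' \<equiv> scroll_order n a b r"
  shows "\<exists>u F. leading_monomial r' h = u + leading_monomial r' F \<and>
    F \<in> scroll_ideal n a b I \<and> F \<noteq> 0 \<and> (\<exists>d\<le>\<delta>. form_of_degree d F) \<and>
    total_degree (leading_monomial r' F) \<le> \<delta> \<and>
    (squarefree_basis r G \<longrightarrow> (\<forall>v. lookup (leading_monomial r' F) v \<le> 1))"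
proof -
  note r'_order = term_order_scroll_order[OF r, of b, folded r'_def]
  define m where "m = leading_monomial r' h"
  have "keys h \<subseteq> monomials (zvars n a b)" using h(1) by (simp add: scroll_ideal_iff[OF I])
  with leading_monomial(1)[OF r'_order h(2)] have mV: "m \<in> monomials (zvars n a b)"
    by (auto simp: m_def)
  have GI: "G \<subseteq> I - {0}" using G(1) by (simp add: groebner_basis_def)
  have IV: "keys f \<subseteq> monomials (xvars n a)" if "f \<in> I" for f
    using ideal.Icarr[OF I that] by simp
  from leading_monomial_scroll[OF I r h m_def[unfolded r'_def, symmetric]] show ?thesis
  proof (elim disjE)
    assume "\<exists>f\<in>I. f \<noteq> 0 \<and> leading_monomial r f = scroll_map m"
    then obtain f where f: "f \<in> I" "f \<noteq> 0" "leading_monomial r f = scroll_map m" by blast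
    obtain g t where g: "g \<in> G" "leading_monomial r f = t + leading_monomial r g"
      by (rule groebner_basis_divides[OF r I G(1) f(1,2)])
    have gI: "g \<in> I" "g \<noteq> 0" using g(1) GI by auto
    have deg: "total_degree (leading_monomial r g) \<le> \<delta>"
      using G(2) g(1) leading_monomial(1)[OF r gI(2) IV[OF gI(1)]]
      by (auto simp: forms_of_degree_le_def form_of_degree_def)
    have "lookup (leading_monomial r g) x \<le> lookup (scroll_map m) x" for x
      using g(2) f(3) by (metis le_add2 lookup_add)
    from covering_divisor[OF this] obtain u m' where m': "m = u + m'"
        "total_degree m' \<le> total_degree (leading_monomial r g)"
      and cov: "\<And>x. lookup (leading_monomial r g) x \<le> lookup (scroll_map m') x"
      and sqf: "(\<forall>x. lookup (leading_monomial r g) x \<le> 1) \<longrightarrow> (\<forall>v. lookup m' v \<le> 1)"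
      by blast
    have m'V: "m' \<in> monomials (zvars n a b)" using mV m'(1) by simp
    obtain w where w: "scroll_map m' = w + leading_monomial r g"
      by (rule monomial_divides[OF cov])
    have wV: "w \<in> monomials (xvars n a)"
      using scroll_map_in_monomials[OF m'V] by (simp add: w)
    let ?f = "single w 1 * g"
    have "?f \<in> I" using ideal.I_l_closed[OF I gI(1), of "single w 1"] wV by simp
    moreover have lead_f: "leading_monomial r ?f = scroll_map m'"
      unfolding w by (rule leading_monomial_single_times[OF r gI(2) IV[OF gI(1)] wV])
    moreover have "keys ?f \<noteq> {}"
      using leading_monomial(1)[OF r gI(2) IV[OF gI(1)]] by (auto simp: keys_single_times)
    then have "?f \<noteq> 0" by (metis keys_zero)
    ultimately obtain F where F: "F \<in> scroll_ideal n a b I" "F \<noteq> 0"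
        "form_of_degree (total_degree m') F" "leading_monomial r' F = m'"
      unfolding r'_def using form_lift[OF I multi r _ _ _ m'V] by metis
    have "squarefree_basis r G \<longrightarrow> (\<forall>v. lookup m' v \<le> 1)"
      using sqf g(1) by (simp add: squarefree_basis_def)
    moreover have "total_degree m' \<le> \<delta>" using m'(2) deg by simp
    ultimately show ?thesis using F m'(1) unfolding m_def[symmetric] by blast
  next
    assume "\<exists>s\<in>monomials (zvars n a b). s \<noteq> m \<and> scroll_map s = scroll_map m \<and>
      weight (spread a) s \<le> weight (spread a) m"
    then obtain s where s: "s \<in> monomials (zvars n a b)" "scroll_map s = scroll_map m" "s \<noteq> m"
      "weight (spread a) s \<le> weight (spread a) m" by blast
    obtain z z' u q' where z: "z \<noteq> z'" and m: "m = u + (single z 1 + single z' 1)"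
      and q': "q' \<in> monomials (zvars n a b)" "total_degree q' = 2"
        "scroll_map q' = scroll_map (single z 1 + single z' 1)"
        "weight (spread a) q' < weight (spread a) (single z 1 + single z' 1)"
      by (rule quadratic_divisor[OF b s(1) mV s(2-4)])
    let ?q = "single z (1 :: nat) + single z' 1"
    have q: "?q \<in> monomials (zvars n a b)" "total_degree ?q = 2"
      using mV by (simp_all add: m total_degree_plus)
    obtain F where F: "F \<in> scroll_ideal n a b I" "F \<noteq> 0"
        "form_of_degree (total_degree ?q) F" "leading_monomial r' F = ?q"
      unfolding r'_def
      by (rule binomial_in_scroll_ideal[OF I r q(1) q'(1,3,4)]) (use q q' in simp_all)
    have "\<forall>v. lookup ?q v \<le> 1"
      using z by (auto simp: lookup_add lookup_single when_def)
    then show ?thesis using F m q(2) \<delta> unfolding m_def[symmetric] by metis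
  qed
qed

theorem proposition5p4:
  fixes n :: nat and a :: "nat \<Rightarrow> nat" and \<delta> :: nat
    and I :: "(nat \<times> nat, 'k::field) mpoly set"
    and r :: "(nat \<times> nat) monomial rel"
    and G :: "(nat \<times> nat, 'k) mpoly set"
  assumes "\<forall>i\<in>{1..n}. 0 < a i"
    and "ideal I (mpoly_ring (xvars n a))"
    and "multigraded I"
    and "2 \<le> \<delta>"
    and "term_order (xvars n a) r"
    and "groebner_basis (xvars n a) r I G"
    and "forms_of_degree_le \<delta> G"
  shows "\<forall>b :: nat \<Rightarrow> nat. (\<forall>i\<in>{1..n}. 0 < b i) \<longrightarrow>
    (\<exists>(r' :: (nat \<times> (nat \<Rightarrow>\<^sub>0 nat)) monomial rel) H.
       term_order (zvars n a b) r' \<and>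
       groebner_basis (zvars n a b) r' (scroll_ideal n a b I) H \<and>
       forms_of_degree_le \<delta> H \<and>
       (squarefree_basis r G \<longrightarrow> squarefree_basis r' H))"
proof (intro allI impI)
  fix b :: "nat \<Rightarrow> nat" assume b: "\<forall>i\<in>{1..n}. 0 < b i"
  define r' where "r' = scroll_order n a b r"
  note r'_order = term_order_scroll_order[OF assms(5), of b, folded r'_def]
  let ?J = "scroll_ideal n a b I"
  define good where "good F \<longleftrightarrow> F \<in> ?J \<and> F \<noteq> 0 \<and> (\<exists>d\<le>\<delta>. form_of_degree d F) \<and>
    total_degree (leading_monomial r' F) \<le> \<delta> \<and>
    (squarefree_basis r G \<longrightarrow> (\<forall>v. lookup (leading_monomial r' F) v \<le> 1))" for F
  define M where "M = leading_monomial r' ` Collect good"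
  \<comment> \<open>A Groebner basis needs only one polynomial for each leading monomial, and there are finitely many.\<close>
  define pick where "pick m = (SOME F. good F \<and> leading_monomial r' F = m)" for m
  have pick: "good (pick m)" "leading_monomial r' (pick m) = m" if "m \<in> M" for m
    using someI_ex[of "\<lambda>F. good F \<and> leading_monomial r' F = m"] that
    unfolding M_def pick_def by blast+
  have JV: "keys F \<subseteq> monomials (zvars n a b)" if "F \<in> ?J" for F
    using that by (simp add: scroll_ideal_iff[OF assms(2)])
  have "M \<subseteq> {m \<in> monomials (zvars n a b). total_degree m \<le> \<delta>}"
    using leading_monomial(1)[OF r'_order _ JV] JV unfolding M_def good_def by blast
  then have "finite M"
    using finite_monomials_total_degree_le[OF finite_zvars] by (rule finite_subset)
  have "groebner_basis (zvars n a b) r' ?J (pick ` M)"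
  proof (rule groebner_basisI[OF r'_order])
    show "finite (pick ` M)" using \<open>finite M\<close> by simp
    show "pick ` M \<subseteq> ?J - {0}" using pick(1) by (auto simp: good_def)
    show "keys f \<subseteq> monomials (zvars n a b)" if "f \<in> ?J" for f by (rule JV[OF that])
    fix f assume "f \<in> ?J" "f \<noteq> 0"
    then obtain u F where F: "leading_monomial r' f = u + leading_monomial r' F" "good F"
      using scroll_leading_monomial_divisor[OF assms(2-7) b] unfolding r'_def good_def by blast
    then have "leading_monomial r' F \<in> M" by (simp add: M_def)
    with F(1) pick(2) show "\<exists>h\<in>pick ` M. \<exists>u. leading_monomial r' f = u + leading_monomial r' h"
      by (metis image_eqI)
  qed
  moreover have "forms_of_degree_le \<delta> (pick ` M)"
    using pick(1) by (auto simp: forms_of_degree_le_def good_def)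
  moreover have "squarefree_basis r G \<longrightarrow> squarefree_basis r' (pick ` M)"
    using pick(1) by (auto simp: squarefree_basis_def good_def)
  ultimately show "\<exists>r' H. term_order (zvars n a b) r' \<and> groebner_basis (zvars n a b) r' ?J H \<and>
      forms_of_degree_le \<delta> H \<and> (squarefree_basis r G \<longrightarrow> squarefree_basis r' H)"
    using r'_order by blast
qed

end
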